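(* Let $\mathbb{F}_q$ be a finite field of characteristic $p\ge 5$, let $d=q+1$, and let $\chi$ be a multiplicative character of $\mathbb{F}_{q^2}$ whose order is greater than $2$ and divides $d$, extended by $\chi(0)=0$. Let $N$ denote the number of $c\in\mathbb{F}_q$ such that $$\sum_{x\in\mathbb{F}_{q^2}}\chi\big(x(x+1)(x+c)\big)=2q.$$ Then $$N\le\frac{3q-9}{4}.$$
   Context: A multiplicative character of $\mathbb{F}_{q^2}$ is a group homomorphism $\chi:\mathbb{F}_{q^2}^*\to\mathbb{C}^*$; its order is its order in the character group. *)

theory Defs
  imports Complex_Main "HOL-Library.Cardinality" "HOL-Algebra.Multiplicative_Group"
begin

definition is_subfield :: "'a::field set \<Rightarrow> bool" where
  "is_subfield K \<longleftrightarrow>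
     0 \<in> K \<and> 1 \<in> K \<and>
     (\<forall>x\<in>K. \<forall>y\<in>K. x - y \<in> K \<and> x * y \<in> K) \<and>
     (\<forall>x\<in>K. x \<noteq> 0 \<longrightarrow> inverse x \<in> K)"

(* A homomorphism from the nonzero elements to the nonzero complex numbers, extended to
   the whole field by the value 0 at 0.  The convention at 0 applies to every character,
   the trivial one included, so that characters are determined by their values on
   nonzero elements. *)
definition mult_char :: "('a::field \<Rightarrow> complex) \<Rightarrow> bool" where
  "mult_char \<chi> \<longleftrightarrow>
     \<chi> 0 = 0 \<and>
     (\<forall>x. x \<noteq> 0 \<longrightarrow> \<chi> x \<noteq> 0) \<and>
     (\<forall>x y. x \<noteq> 0 \<longrightarrow> y \<noteq> 0 \<longrightarrow> \<chi> (x * y) = \<chi> x * \<chi> y)"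

definition char_group :: "('a::field \<Rightarrow> complex) monoid" where
  "char_group =
     \<lparr>carrier = {\<chi>. mult_char \<chi>},
      mult = (\<lambda>\<chi> \<psi> x. \<chi> x * \<psi> x),
      one = (\<lambda>x. if x = 0 then 0 else 1)\<rparr>"

lemma comm_group_char_group: "comm_group (char_group :: ('a::field \<Rightarrow> complex) monoid)"
proof (rule comm_groupI)
  fix \<chi> :: "'a \<Rightarrow> complex"
  assume \<chi>: "\<chi> \<in> carrier char_group"
  show "\<one>\<^bsub>char_group\<^esub> \<otimes>\<^bsub>char_group\<^esub> \<chi> = \<chi>"
    using \<chi> by (auto simp: char_group_def mult_char_def fun_eq_iff)
  show "\<exists>\<psi>\<in>carrier char_group. \<psi> \<otimes>\<^bsub>char_group\<^esub> \<chi> = \<one>\<^bsub>char_group\<^esub>"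
    using \<chi>
    by (intro bexI[of _ "\<lambda>x. inverse (\<chi> x)"])
       (auto simp: char_group_def mult_char_def fun_eq_iff)
qed (auto simp: char_group_def mult_char_def fun_eq_iff mult_ac)

definition char_order :: "('a::field \<Rightarrow> complex) \<Rightarrow> nat" where
  "char_order \<chi> = group.ord char_group \<chi>"

end

theory Submission
  imports Defs "HOL-Algebra.Algebraic_Closure_Type" "HOL-Algebra.Sylow"
begin

text \<open>
  Write \<open>S(c)\<close> for the sum over the field with \<open>q^2\<close> elements and \<open>K\<close> for the subfield with \<open>q\<close>
  elements. The proof compares the first moment of \<open>S\<close> over \<open>K\<close> with the Weil bound.

  The order of \<open>\<chi>\<close> divides \<open>q + 1\<close> and the nonzero elements of \<open>K\<close> are \<open>(q + 1)\<close>-th powers, so \<open>\<chi>\<close> is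
  trivial on them. Therefore \<open>\<chi>\<close> sums to \<open>-1\<close> over every affine line \<open>x + K\<close> other than \<open>K\<close>
  (\<open>sum_affine_line\<close>), and this evaluates several sums exactly: \<open>\<Sum>c\<in>K. S(c)\<close> equals \<open>q^2 - 3 q\<close>
  (\<open>sum_cubic_sums\<close>), and \<open>S(0) = S(1) = q\<close> if \<open>\<chi>^3\<close> is nontrivial (\<open>cubic_sum_degenerate\<close>). For the
  other \<open>q - 2\<close> values of \<open>c\<close> the Weil bound gives \<open>Re S(c) \<ge> -2 q\<close>. If \<open>N\<close> of them attain \<open>2 q\<close>, then
  \<open>2 q N - 2 q (q - 2 - N) \<le> q^2 - 5 q\<close>, which is the claim. If \<open>\<chi>^3\<close> is trivial, then
  \<open>S(0) = S(1) = -1\<close>, and for the other \<open>c\<close> a sharper form of the bound excludes the value \<open>2 q\<close>.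

  The Weil bound \<open>|S(c)| \<le> 2 q\<close> for \<open>c\<close> other than 0 and 1 (\<open>weil_bound_cubic_sum\<close>) is proved in two
  steps. First, let \<open>S'\<close> be the analogous sum over the quadratic extension of a field with \<open>P\<close>
  elements. Sorting the elements of the extension by their minimal polynomials gives
  \<open>S' + S^2 = 2 a\<close>, where \<open>a\<close> is a sum over all monic quadratic polynomials which reduces to Jacobi
  sums, so that \<open>|a| \<le> P\<close>
  (\<open>norm_cubic_sum_square_le_quadratic_extension\<close>). For the ratios \<open>s\<close> of \<open>|S|\<close> to the square root of
  the field size this says \<open>s^2 \<le> s' + 2\<close>; iterated up the tower of quadratic extensions, a starting
  value above 2 would make \<open>s\<close> grow without bound. Second, Stepanov's method shows that \<open>s\<close> stays
  bounded in the tower (\<open>card_power_residue_values_le\<close>, \<open>norm_cubic_sum_bounded\<close>). The constant obtained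
  is far from 2, and the recursion removes this loss. The tower is realised inside the algebraic
  closure as the fixed fields of powers of Frobenius, and all characters in it are induced by one
  character of the \<open>(q + 1)\<close>-th roots of unity.
\<close>

section \<open>Characters and Jacobi sums of finite subfields\<close>

lemma is_subfieldD:
  assumes "is_subfield K"
  shows "0 \<in> K" "1 \<in> K" "x \<in> K \<Longrightarrow> y \<in> K \<Longrightarrow> x - y \<in> K"
    "x \<in> K \<Longrightarrow> y \<in> K \<Longrightarrow> x + y \<in> K" "x \<in> K \<Longrightarrow> - x \<in> K"
    "x \<in> K \<Longrightarrow> y \<in> K \<Longrightarrow> x * y \<in> K" "x \<in> K \<Longrightarrow> inverse x \<in> K"
    "x \<in> K \<Longrightarrow> y \<in> K \<Longrightarrow> x / y \<in> K" "x \<in> K \<Longrightarrow> x ^ n \<in> K"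
proof -
  show 0: "0 \<in> K" and 1: "1 \<in> K" using assms by (auto simp: is_subfield_def)
  show diff: "x - y \<in> K" if "x \<in> K" "y \<in> K" for x y
    using assms that by (auto simp: is_subfield_def)
  show mult: "x * y \<in> K" if "x \<in> K" "y \<in> K" for x y
    using assms that by (auto simp: is_subfield_def)
  show inv: "inverse x \<in> K" if "x \<in> K" for x
    using assms that 0 by (cases "x = 0") (auto simp: is_subfield_def)
  show minus: "- x \<in> K" if "x \<in> K" for x using diff[OF 0 that] by simp
  show "x + y \<in> K" if "x \<in> K" "y \<in> K" for x y using diff[OF that(1) minus[OF that(2)]] by simp
  show "x / y \<in> K" if "x \<in> K" "y \<in> K" for x y
    using mult[OF that(1) inv[OF that(2)]] by (simp add: divide_inverse)
  show "x ^ n \<in> K" if "x \<in> K" for x n by (induction n) (auto intro: 1 mult that)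
qed

text \<open>
  The values on \<open>K\<close> alone matter, so that one function on a large field can serve as a
  character of several of its finite subfields.
\<close>

definition char_on :: "'a::field set \<Rightarrow> ('a \<Rightarrow> complex) \<Rightarrow> bool" where
  "char_on K \<chi> \<longleftrightarrow> \<chi> 0 = 0 \<and> (\<forall>x\<in>K. \<forall>y\<in>K. \<chi> (x * y) = \<chi> x * \<chi> y) \<and>
     (\<forall>x\<in>K. x \<noteq> 0 \<longrightarrow> norm (\<chi> x) = 1)"

lemma char_on_simps:
  assumes "char_on K \<chi>"
  shows "\<chi> 0 = 0" "x \<in> K \<Longrightarrow> y \<in> K \<Longrightarrow> \<chi> (x * y) = \<chi> x * \<chi> y"
    "x \<in> K \<Longrightarrow> x \<noteq> 0 \<Longrightarrow> norm (\<chi> x) = 1"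
  using assms by (auto simp: char_on_def)

lemma char_on_1:
  assumes "char_on K \<chi>" "is_subfield K"
  shows "\<chi> 1 = 1"
proof -
  have "\<chi> 1 = \<chi> 1 * \<chi> 1" "norm (\<chi> 1) = 1"
    using char_on_simps(2)[OF assms(1), of 1 1] char_on_simps(3)[OF assms(1), of 1]
      is_subfieldD(2)[OF assms(2)] by auto
  thus ?thesis by (metis mult_cancel_left1 norm_zero zero_neq_one)
qed

lemma char_on_mult: "char_on K \<chi> \<Longrightarrow> char_on K \<psi> \<Longrightarrow> char_on K (\<lambda>x. \<chi> x * \<psi> x)"
  by (auto simp: char_on_def norm_mult)

lemma char_on_divide:
  assumes "char_on K \<chi>" "is_subfield K" "x \<in> K" "y \<in> K"
  shows "\<chi> (x / y) = \<chi> x * cnj (\<chi> y)"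
proof (cases "y = 0")
  case False
  have "\<chi> x = \<chi> (x / y) * \<chi> y"
    using char_on_simps(2)[OF assms(1), of "x / y" y] False is_subfieldD[OF assms(2)] assms by simp
  moreover have "\<chi> y * cnj (\<chi> y) = 1"
    using char_on_simps(3)[OF assms(1) assms(4) False] by (simp add: complex_norm_square[symmetric])
  ultimately show ?thesis by (simp add: mult.assoc)
qed (auto simp: char_on_simps[OF assms(1)])

lemma sum_char_on_eq_0:
  assumes "char_on K \<chi>" "is_subfield K" "finite K" "a \<in> K" "a \<noteq> 0" "\<chi> a \<noteq> 1"
  shows "(\<Sum>x\<in>K. \<chi> x) = 0"
proof -
  have "(\<Sum>x\<in>K. \<chi> x) = (\<Sum>x\<in>K. \<chi> (a * x))"
    by (rule sum.reindex_bij_witness[of _ "\<lambda>x. a * x" "\<lambda>x. x / a"])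
       (use assms is_subfieldD[OF assms(2)] in auto)
  also have "\<dots> = \<chi> a * (\<Sum>x\<in>K. \<chi> x)"
    unfolding sum_distrib_left
    by (intro sum.cong refl char_on_simps(2)[OF assms(1)] assms)
  finally show ?thesis using assms(6) by simp
qed

text \<open>
  Expanding \<open>J * cnj J\<close> as a double sum over \<open>s\<close> and \<open>t = s * r\<close> leaves \<open>\<chi> r\<close> times a
  sum over \<open>s\<close> of \<open>\<psi>\<close> at the Moebius transform \<open>(1 - s * r) / (1 - s)\<close>. For \<open>r\<close> other than 1
  that transform permutes the projective line over \<open>K\<close>, so the inner sum is a complete character
  sum with two values removed. The single formula covers both the case \<open>|J|^2 = |K|\<close> and the
  degenerate case in which \<open>\<chi> * \<psi>\<close> is trivial.
\<close>

lemma norm_jacobi_sum: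
  assumes "char_on K \<chi>" "char_on K \<psi>" "is_subfield K" "finite K"
    and "(\<Sum>x\<in>K. \<chi> x) = 0" "(\<Sum>x\<in>K. \<psi> x) = 0"
  shows "complex_of_real ((norm (\<Sum>x\<in>K. \<chi> x * \<psi> (1 - x)))\<^sup>2) =
           of_nat (card K) - (\<Sum>x\<in>K. \<chi> x * \<psi> x)"
proof -
  note K = is_subfieldD[OF assms(3)]
  note \<chi> = char_on_simps[OF assms(1)] char_on_1[OF assms(1,3)]
  note \<psi> = char_on_simps[OF assms(2)] char_on_1[OF assms(2,3)]
  let ?K = "K - {0, 1}"
  have split2: "(\<Sum>x\<in>K. f x) = f 0 + f 1 + (\<Sum>x\<in>?K. f x)" for f :: "'a \<Rightarrow> complex"
  proof -
    have "K = insert 0 (insert 1 ?K)" using K by auto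
    hence "sum f K = sum f (insert 0 (insert 1 ?K))" by simp
    also have "\<dots> = f 0 + f 1 + sum f ?K" using assms(4) by simp
    finally show ?thesis .
  qed
  have inner: "(\<Sum>s\<in>?K. \<psi> (1 - s * r) * cnj (\<psi> (1 - s))) = (if r = 1 then of_nat (card K) - 2 else - \<psi> r - 1)"
    if r: "r \<in> K" for r
  proof (cases "r = 1")
    case True
    have "(\<Sum>s\<in>?K. \<psi> (1 - s * r) * cnj (\<psi> (1 - s))) = (\<Sum>s\<in>?K. 1)"
    proof (rule sum.cong[OF refl])
      fix s assume "s \<in> ?K"
      hence "norm (\<psi> (1 - s)) = 1" using K \<psi>(3)[of "1 - s"] by auto
      thus "\<psi> (1 - s * r) * cnj (\<psi> (1 - s)) = 1"
        using True by (simp add: complex_norm_square[symmetric])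
    qed
    also have "\<dots> = (\<Sum>s\<in>K. 1) - 2" using split2[of "\<lambda>_. 1"] by simp
    finally show ?thesis using True by simp
  next
    case False
    have "(\<Sum>s\<in>?K. \<psi> (1 - s * r) * cnj (\<psi> (1 - s))) = (\<Sum>s\<in>?K. \<psi> ((1 - s * r) / (1 - s)))"
      by (rule sum.cong) (auto simp: char_on_divide[OF assms(2,3)] K r)
    also have "\<dots> = (\<Sum>w\<in>K-{r, 1}. \<psi> w)"
      \<comment> \<open>the two exclusions are the values at s = infinity and s = 0\<close>
    proof (rule sum.reindex_bij_witness[of _ "\<lambda>w. (w - 1) / (w - r)" "\<lambda>s. (1 - s * r) / (1 - s)"])
      fix s assume s: "s \<in> ?K"
      have ne: "1 - s \<noteq> 0" "1 - r \<noteq> 0" "s \<noteq> 0" using s False by auto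
      have e1: "(1 - s * r) / (1 - s) - 1 = s * (1 - r) / (1 - s)"
        and e2: "(1 - s * r) / (1 - s) - r = (1 - r) / (1 - s)"
        using ne by (auto simp: divide_simps algebra_simps)
      show "((1 - s * r) / (1 - s) - 1) / ((1 - s * r) / (1 - s) - r) = s"
        unfolding e1 e2 using ne by simp
      have "(1 - s * r) / (1 - s) - 1 \<noteq> 0" "(1 - s * r) / (1 - s) - r \<noteq> 0"
        unfolding e1 e2 using ne by auto
      thus "(1 - s * r) / (1 - s) \<in> K - {r, 1}" using s r K by auto
    next
      fix w assume w: "w \<in> K - {r, 1}"
      have ne: "w - r \<noteq> 0" "1 - r \<noteq> 0" "w - 1 \<noteq> 0" using w False by auto
      have e1: "1 - (w - 1) / (w - r) * r = w * (1 - r) / (w - r)"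
        and e2: "1 - (w - 1) / (w - r) = (1 - r) / (w - r)"
        using ne by (auto simp: divide_simps algebra_simps)
      show "(1 - (w - 1) / (w - r) * r) / (1 - (w - 1) / (w - r)) = w"
        unfolding e1 e2 using ne by simp
      have "1 - (w - 1) / (w - r) \<noteq> 0" unfolding e2 using ne by simp
      thus "(w - 1) / (w - r) \<in> ?K" using ne w r K by auto
    qed auto
    also have "\<dots> = (\<Sum>w\<in>K. \<psi> w) - \<psi> r - \<psi> 1"
    proof -
      have "(\<Sum>w\<in>K. \<psi> w) = (\<Sum>w\<in>insert r (insert 1 (K - {r, 1})). \<psi> w)"
        by (rule sum.cong) (use r K in auto)
      also have "\<dots> = \<psi> r + \<psi> 1 + (\<Sum>w\<in>K-{r, 1}. \<psi> w)"
        using assms(4) False by (simp add: add_ac)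
      finally show ?thesis by simp
    qed
    finally show ?thesis using False assms(6) \<psi> by simp
  qed
  let ?J = "\<Sum>x\<in>K. \<chi> x * \<psi> (1 - x)"
  have J: "?J = (\<Sum>s\<in>?K. \<chi> s * \<psi> (1 - s))"
    by (subst split2) (simp add: \<chi> \<psi>)
  have "complex_of_real ((norm ?J)\<^sup>2) = ?J * cnj ?J" by (rule complex_norm_square)
  also have "\<dots> = (\<Sum>s\<in>?K. \<Sum>t\<in>K. \<chi> t * \<psi> (1 - t) * cnj (\<chi> s * \<psi> (1 - s)))"
    by (subst (2) J) (simp add: sum_distrib_left sum_distrib_right)
  also have "\<dots> = (\<Sum>s\<in>?K. \<Sum>r\<in>K. \<chi> r * (\<psi> (1 - s * r) * cnj (\<psi> (1 - s))))"
  proof (rule sum.cong[OF refl])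
    fix s assume s: "s \<in> ?K"
    hence one: "\<chi> s * cnj (\<chi> s) = 1"
      using \<chi>(3)[of s] by (simp add: complex_norm_square[symmetric])
    have "(\<Sum>t\<in>K. \<chi> t * \<psi> (1 - t) * cnj (\<chi> s * \<psi> (1 - s))) =
          (\<Sum>r\<in>K. \<chi> (s * r) * \<psi> (1 - s * r) * cnj (\<chi> s * \<psi> (1 - s)))"
      by (rule sum.reindex_bij_witness[of _ "\<lambda>r. s * r" "\<lambda>t. t / s"]) (use s K in auto)
    also have "\<dots> = (\<Sum>r\<in>K. \<chi> r * (\<psi> (1 - s * r) * cnj (\<psi> (1 - s))))"
    proof (rule sum.cong[OF refl])
      fix r assume r: "r \<in> K"
      have "\<chi> (s * r) * \<psi> (1 - s * r) * cnj (\<chi> s * \<psi> (1 - s)) =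
          (\<chi> s * cnj (\<chi> s)) * (\<chi> r * (\<psi> (1 - s * r) * cnj (\<psi> (1 - s))))"
        using s r by (simp add: \<chi>)
      thus "\<chi> (s * r) * \<psi> (1 - s * r) * cnj (\<chi> s * \<psi> (1 - s)) =
          \<chi> r * (\<psi> (1 - s * r) * cnj (\<psi> (1 - s)))" unfolding one by simp
    qed
    finally show "(\<Sum>t\<in>K. \<chi> t * \<psi> (1 - t) * cnj (\<chi> s * \<psi> (1 - s))) =
      (\<Sum>r\<in>K. \<chi> r * (\<psi> (1 - s * r) * cnj (\<psi> (1 - s))))" .
  qed
  also have "\<dots> = (\<Sum>r\<in>K. \<chi> r * (\<Sum>s\<in>?K. \<psi> (1 - s * r) * cnj (\<psi> (1 - s))))"
    by (subst sum.swap) (simp add: sum_distrib_left)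
  also have "\<dots> = (\<Sum>r\<in>K. \<chi> r * (if r = 1 then of_nat (card K) - 2 else - \<psi> r - 1))"
    by (rule sum.cong) (auto simp: inner)
  also have "\<dots> = of_nat (card K) - 2 + (\<Sum>r\<in>?K. - (\<chi> r * \<psi> r) - \<chi> r)"
    by (subst split2) (auto simp: \<chi> algebra_simps intro!: sum.cong)
  also have "\<dots> = of_nat (card K) - 2 - (\<Sum>r\<in>?K. \<chi> r * \<psi> r) - (\<Sum>r\<in>?K. \<chi> r)"
    by (simp add: sum_subtractf sum_negf)
  also have "\<dots> = of_nat (card K) - (\<Sum>x\<in>K. \<chi> x * \<psi> x)"
    using split2[of "\<lambda>x. \<chi> x * \<psi> x"] split2[of \<chi>] assms(5) \<chi> \<psi> by (simp add: algebra_simps)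
  finally show ?thesis .
qed

text \<open>
  Substituting \<open>v = (1 - u) * t\<close> in the inner sum factors the double sum as the Jacobi sum of
  \<open>\<chi>, \<chi>\<close> times that of \<open>\<chi>, \<chi>^2\<close>; the line \<open>u = 1\<close>, on which the substitution breaks
  down, contributes a multiple of the sum of \<open>\<chi>^2\<close>.
\<close>

lemma norm_double_jacobi_sum:
  assumes "char_on K \<chi>" "is_subfield K" "finite K"
    and "(\<Sum>x\<in>K. \<chi> x) = 0" "(\<Sum>x\<in>K. \<chi> x ^ 2) = 0"
  shows "complex_of_real ((norm (\<Sum>u\<in>K. \<Sum>v\<in>K. \<chi> (u * v * (1 - u - v))))\<^sup>2) =
           of_nat (card K) * (of_nat (card K) - (\<Sum>x\<in>K. \<chi> x ^ 3))"
proof -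
  note K = is_subfieldD[OF assms(2)]
  note \<chi> = char_on_simps[OF assms(1)] char_on_1[OF assms(1,2)]
  have sq: "char_on K (\<lambda>x. \<chi> x * \<chi> x)" by (rule char_on_mult) fact+
  let ?J1 = "\<Sum>x\<in>K. \<chi> x * \<chi> (1 - x)" and ?J2 = "\<Sum>x\<in>K. \<chi> x * (\<chi> (1 - x) * \<chi> (1 - x))"
  have inner: "(\<Sum>v\<in>K. \<chi> (u * v * (1 - u - v))) = \<chi> u * (\<chi> (1 - u) * \<chi> (1 - u)) * ?J1"
    if u: "u \<in> K" for u
  proof (cases "u = 1")
    case True
    have "(\<Sum>v\<in>K. \<chi> (u * v * (1 - u - v))) = (\<Sum>v\<in>K. \<chi> (-1) * \<chi> v ^ 2)"
    proof (rule sum.cong[OF refl])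
      fix v assume v: "v \<in> K"
      have "u * v * (1 - u - v) = (-1) * (v * v)" using True by simp
      also have "\<chi> \<dots> = \<chi> (-1) * \<chi> v ^ 2"
        using v K by (subst \<chi>(2), simp_all add: \<chi> power2_eq_square)
      finally show "\<chi> (u * v * (1 - u - v)) = \<chi> (-1) * \<chi> v ^ 2" .
    qed
    thus ?thesis using assms(5) True \<chi> by (simp add: sum_distrib_left[symmetric])
  next
    case False
    have "(\<Sum>v\<in>K. \<chi> (u * v * (1 - u - v))) = (\<Sum>t\<in>K. \<chi> (u * ((1 - u) * t) * (1 - u - (1 - u) * t)))"
      by (rule sum.reindex_bij_witness[of _ "\<lambda>t. (1 - u) * t" "\<lambda>v. v / (1 - u)"])
         (use u K False in auto)
    also have "\<dots> = (\<Sum>t\<in>K. \<chi> u * (\<chi> (1 - u) * \<chi> (1 - u)) * (\<chi> t * \<chi> (1 - t)))"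
    proof (rule sum.cong[OF refl])
      fix t assume t: "t \<in> K"
      have "u * ((1 - u) * t) * (1 - u - (1 - u) * t) = u * ((1 - u) * (1 - u)) * (t * (1 - t))"
        by (simp add: algebra_simps)
      also have "\<chi> \<dots> = \<chi> u * (\<chi> (1 - u) * \<chi> (1 - u)) * (\<chi> t * \<chi> (1 - t))"
        using u t K by (simp add: \<chi>)
      finally show "\<chi> (u * ((1 - u) * t) * (1 - u - (1 - u) * t)) = \<dots>" .
    qed
    finally show ?thesis by (simp add: sum_distrib_left)
  qed
  have "(\<Sum>u\<in>K. \<Sum>v\<in>K. \<chi> (u * v * (1 - u - v))) = (\<Sum>u\<in>K. \<chi> u * (\<chi> (1 - u) * \<chi> (1 - u)) * ?J1)"
    by (rule sum.cong) (auto simp: inner)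
  also have "\<dots> = ?J2 * ?J1" by (simp add: sum_distrib_right)
  finally show ?thesis
    using norm_jacobi_sum[OF assms(1,1-4,4)] norm_jacobi_sum[OF assms(1) sq assms(2-4)] assms(5)
    by (simp add: norm_mult power_mult_distrib power2_eq_square power3_eq_cube mult_ac)
qed

section \<open>Linear systems and separable polynomials\<close>

text \<open>
  Gaussian elimination: one equation is used to eliminate one unknown.
\<close>

lemma underdetermined_system_solution:
  fixes A :: "'i \<Rightarrow> 'j \<Rightarrow> 'f::field"
  assumes "finite J" "finite I" "card J < card I"
  shows "\<exists>x. (\<exists>i\<in>I. x i \<noteq> 0) \<and> (\<forall>j\<in>J. (\<Sum>i\<in>I. x i * A i j) = 0)"
  using assms
proof (induction J arbitrary: I A rule: finite_induct)
  case empty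
  hence "I \<noteq> {}" by auto
  thus ?case by (intro exI[of _ "\<lambda>_. 1"]) auto
next
  case (insert j0 J)
  show ?case
  proof (cases "\<forall>i\<in>I. A i j0 = 0")
    case True
    have "card J < card I" using insert by simp
    then obtain x where "\<exists>i\<in>I. x i \<noteq> 0" "\<forall>j\<in>J. (\<Sum>i\<in>I. x i * A i j) = 0"
      using insert.IH[OF insert.prems(1), of A] by auto
    thus ?thesis using True by (intro exI[of _ x]) auto
  next
    case False
    then obtain i0 where i0: "i0 \<in> I" "A i0 j0 \<noteq> 0" by auto
    define I' where "I' = I - {i0}"
    have I': "finite I'" "i0 \<notin> I'" "I = insert i0 I'" using insert.prems i0 by (auto simp: I'_def)
    have "card J < card I'" using insert I' by simp
    then obtain x where x: "\<exists>i\<in>I'. x i \<noteq> 0"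
        "\<forall>j\<in>J. (\<Sum>i\<in>I'. x i * (A i j - A i j0 / A i0 j0 * A i0 j)) = 0"
      using insert.IH[OF I'(1), of "\<lambda>i j. A i j - A i j0 / A i0 j0 * A i0 j"] by auto
    define t where "t = - (\<Sum>i\<in>I'. x i * A i j0) / A i0 j0"
    have *: "(\<Sum>i\<in>I. (x(i0 := t)) i * A i j) = t * A i0 j + (\<Sum>i\<in>I'. x i * A i j)" for j
    proof -
      have "(\<Sum>i\<in>I'. (x(i0 := t)) i * A i j) = (\<Sum>i\<in>I'. x i * A i j)"
        by (rule sum.cong) (use I'(2) in auto)
      thus ?thesis unfolding I'(3) using I'(1,2) by simp
    qed
    have "(\<Sum>i\<in>I. (x(i0 := t)) i * A i j) = 0" if "j \<in> insert j0 J" for j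
    proof (cases "j = j0")
      case True
      thus ?thesis unfolding * using i0 by (simp add: t_def)
    next
      case False
      hence "j \<in> J" using that by simp
      hence "0 = (\<Sum>i\<in>I'. x i * A i j) - (\<Sum>i\<in>I'. x i * A i j0) / A i0 j0 * A i0 j"
        using x(2) by (simp add: algebra_simps sum_subtractf sum_distrib_left sum_distrib_right sum_divide_distrib)
      thus ?thesis unfolding * by (simp add: t_def)
    qed
    moreover have "\<exists>i\<in>I. (x(i0 := t)) i \<noteq> 0" using x(1) I' by auto
    ultimately show ?thesis by blast
  qed
qed

lemma card_roots_separable:
  fixes p :: "'b::alg_closed_field poly"
  assumes "p \<noteq> 0" "\<And>x. poly p x = 0 \<Longrightarrow> poly (pderiv p) x \<noteq> 0"
  shows "card {x. poly p x = 0} = degree p"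
  using assms
proof (induction "degree p" arbitrary: p)
  case 0
  then obtain a where "p = [:a:]" by (metis degree_eq_zeroE)
  with 0 show ?case by auto
next
  case (Suc n)
  then obtain a where a: "poly p a = 0"
    using alg_closed_imp_poly_has_root[of p] by auto
  then obtain r where r: "p = [:-a, 1:] * r" using poly_eq_0_iff_dvd by (metis dvdE)
  have "r \<noteq> 0" using Suc.prems r by auto
  hence deg: "degree p = Suc (degree r)" unfolding r by (subst degree_mult_eq) auto
  have pd: "poly (pderiv p) x = poly r x + (x - a) * poly (pderiv r) x" for x
    unfolding r by (subst pderiv_mult) (simp add: pderiv_pCons algebra_simps)
  have ra: "poly r a \<noteq> 0" using Suc.prems(2)[OF a] pd[of a] by simp
  have "card {x. poly r x = 0} = degree r"
  proof (rule Suc.hyps)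
    show "n = degree r" using Suc.hyps(2) deg by simp
    fix x assume x: "poly r x = 0"
    hence "poly p x = 0" by (simp add: r)
    from Suc.prems(2)[OF this] show "poly (pderiv r) x \<noteq> 0" using pd[of x] x by auto
  qed fact
  moreover have "{x. poly p x = 0} = insert a {x. poly r x = 0}" by (auto simp: r)
  ultimately show ?case using ra poly_roots_finite[OF \<open>r \<noteq> 0\<close>] deg by simp
qed

lemma card_nth_roots:
  fixes a :: "'b::alg_closed_field"
  assumes "n > 0" "of_nat n \<noteq> (0::'b)" "a \<noteq> 0"
  shows "finite {x. x ^ n = a}" "card {x. x ^ n = a} = n"
proof -
  define p where "p = monom 1 n - [:a:]"
  have px: "poly p x = x ^ n - a" for x by (simp add: p_def poly_monom)
  have deg: "degree p = n"
    unfolding p_def diff_conv_add_uminus using assms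
    by (subst degree_add_eq_left) (auto simp: degree_monom_eq)
  have "p \<noteq> 0" using deg assms by auto
  have "card {x. poly p x = 0} = degree p"
  proof (rule card_roots_separable)
    fix x assume "poly p x = 0"
    hence "x \<noteq> 0" using assms by (auto simp: px power_0_left)
    thus "poly (pderiv p) x \<noteq> 0"
      using assms by (simp add: p_def pderiv_diff pderiv_monom poly_monom pderiv_pCons)
  qed fact
  thus "card {x. x ^ n = a} = n" by (simp add: px deg)
  show "finite {x. x ^ n = a}" using poly_roots_finite[OF \<open>p \<noteq> 0\<close>] by (simp add: px)
qed

text \<open>
  For a power \<open>P\<close> of the characteristic of an algebraically closed field this is the subfield
  with \<open>P\<close> elements.
\<close>

definition fixfield :: "nat \<Rightarrow> 'b::field set" where
  "fixfield P = {x. x ^ P = x}"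

lemma card_fixfield:
  assumes "P > 1" "of_nat P = (0::'b::alg_closed_field)"
  shows "finite (fixfield P :: 'b set)" "card (fixfield P :: 'b set) = P"
proof -
  define p :: "'b poly" where "p = monom 1 P - [:0, 1:]"
  have px: "poly p x = x ^ P - x" for x by (simp add: p_def poly_monom)
  have deg: "degree p = P"
    unfolding p_def diff_conv_add_uminus using assms
    by (subst degree_add_eq_left) (auto simp: degree_monom_eq)
  have "p \<noteq> 0" using deg assms by auto
  have "card {x. poly p x = 0} = degree p"
    by (rule card_roots_separable)
       (use \<open>p \<noteq> 0\<close> assms in \<open>auto simp: p_def pderiv_diff pderiv_monom poly_monom pderiv_pCons\<close>)
  thus "card (fixfield P :: 'b set) = P" by (simp add: px deg fixfield_def)
  show "finite (fixfield P :: 'b set)"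
    using poly_roots_finite[OF \<open>p \<noteq> 0\<close>] by (simp add: px fixfield_def)
qed

lemma is_subfield_fixfield:
  assumes "prime CHAR('b::field)" "P = CHAR('b) ^ k"
  shows "is_subfield (fixfield P :: 'b set)"
proof -
  have "P > 0" using assms by (simp add: prime_gt_0_nat)
  have add: "(x + y) ^ P = x ^ P + y ^ P" for x y :: 'b
    using freshmans_dream'[OF assms] .
  have "(x - y) ^ P = x ^ P - y ^ P" for x y :: 'b
    using add[of "x - y" y] by simp
  thus ?thesis
    using \<open>P > 0\<close> by (auto simp: is_subfield_def fixfield_def power_mult_distrib power_inverse)
qed

section \<open>Stepanov's method for superelliptic curves\<close>

text \<open>
  On the curve \<open>y^d = h(x)\<close> with \<open>deg h = d - 1\<close> the coordinates \<open>x\<close> and \<open>y\<close> have poles of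
  orders \<open>d\<close> and \<open>d - 1\<close> at the single point at infinity. Every number from \<open>(d - 1)^2\<close> on
  therefore is the pole order of a monomial \<open>x^i y^j\<close> with \<open>j < d\<close>.
\<close>

lemma weight_of_curve_monomial_exists:
  assumes "(d - 1)\<^sup>2 \<le> w" "d > (0::nat)"
  shows "\<exists>i j. j < d \<and> w = d * i + (d - 1) * j"
proof -
  define j where "j = (d - w mod d) mod d"
  have j: "j < d" using assms by (simp add: j_def)
  have le: "(d - 1) * j \<le> w"
  proof -
    have "(d - 1) * j \<le> (d - 1) * (d - 1)" using j by (intro mult_left_mono) auto
    also have "\<dots> \<le> w" using assms(1) by (simp only: power2_eq_square)
    finally show ?thesis .
  qed
  have "d dvd w + j"
  proof (cases "w mod d = 0")
    case False
    have "w mod d < d" using assms by simp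
    hence "j = d - w mod d" using False by (simp add: j_def)
    hence "w + j = d * (w div d) + d"
      using \<open>w mod d < d\<close> mult_div_mod_eq[of d w] by linarith
    thus ?thesis by simp
  qed (auto simp: j_def dvd_eq_mod_eq_0)
  moreover have "w - (d - 1) * j + d * j = w + j"
    using le assms by (cases d) auto
  ultimately have "d dvd w - (d - 1) * j"
    by (metis dvd_add_left_iff dvd_triv_left)
  then obtain i where "w - (d - 1) * j = d * i" by blast
  thus ?thesis using le j by (intro exI[of _ i] exI[of _ j]) auto
qed

text \<open>
  The coefficient of \<open>y^(e mod d)\<close> when \<open>x^a y^e\<close> is reduced with \<open>y^d = h(x)\<close>.
\<close>

definition curve_monom :: "'b::field poly \<Rightarrow> nat \<Rightarrow> nat \<Rightarrow> nat \<Rightarrow> 'b poly" where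
  "curve_monom h d a e = monom 1 a * h ^ (e div d)"

lemma curve_monom:
  assumes "degree h = d - 1" "h \<noteq> 0" "d > 0"
  shows "d * degree (curve_monom h d a e) + (d - 1) * (e mod d) = d * a + (d - 1) * e"
    and "curve_monom h d a e \<noteq> 0"
    and "y ^ d = poly h z \<Longrightarrow> poly (curve_monom h d a e) z * y ^ (e mod d) = z ^ a * y ^ e"
proof -
  have deg: "degree (curve_monom h d a e) = a + (d - 1) * (e div d)"
    unfolding curve_monom_def using assms
    by (subst degree_mult_eq) (auto simp: degree_monom_eq degree_power_eq mult.commute)
  have "d * degree (curve_monom h d a e) + (d - 1) * (e mod d) =
      d * a + (d - 1) * (d * (e div d) + e mod d)"
    unfolding deg distrib_left by (simp add: mult.left_commute)
  thus "d * degree (curve_monom h d a e) + (d - 1) * (e mod d) = d * a + (d - 1) * e"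
    by (simp only: mult_div_mod_eq)
  show "curve_monom h d a e \<noteq> 0" using assms by (auto simp: curve_monom_def)
  assume y: "y ^ d = poly h z"
  have "poly (curve_monom h d a e) z * y ^ (e mod d) = z ^ a * (y ^ (d * (e div d)) * y ^ (e mod d))"
    unfolding curve_monom_def using y by (simp add: poly_monom power_mult)
  also have "y ^ (d * (e div d)) * y ^ (e mod d) = y ^ e"
    by (simp flip: power_add)
  finally show "poly (curve_monom h d a e) z * y ^ (e mod d) = z ^ a * y ^ e" .
qed

text \<open>
  Stepanov's method in the form given to it by Bombieri. The points counted are the
  abscissae of the points of \<open>y^d = h(x)\<close>, with \<open>y\<close> nonzero, over the field with \<open>R^2\<close> elements.
  Consider functions \<open>G = \<Sum> a(u,v) m_v m_u^R\<close>, where \<open>m_w\<close> is the monomial of weight \<open>w\<close> and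
  \<open>v < R\<close>. Raising to the \<open>R\<close>-th power and using \<open>x^(R^2) = x\<close> at a rational point turns \<open>G^R\<close>
  into the value of \<open>E = \<Sum> a(u,v)^R m_v^R m_u\<close>. Requiring \<open>E = 0\<close> identically is a linear
  system for the numbers \<open>a(u,v)^R\<close> with fewer equations than unknowns, while the weights
  \<open>v + R u\<close> of the terms of \<open>G\<close> are distinct, so \<open>G\<close> does not vanish identically. All \<open>d\<close> values
  of \<open>y\<close> over an admissible \<open>x\<close> are rational, hence every coefficient of \<open>G\<close> with respect to the powers
  \<open>1, y, ..., y^(d-1)\<close> vanishes at \<open>x\<close>, and the degree of a nonzero coefficient bounds the
  number of such \<open>x\<close>. Passing to \<open>R\<close>-th powers takes the place of derivatives.
\<close>

lemma card_power_residue_values_le: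
  fixes h :: "'b::alg_closed_field poly"
  assumes p: "prime CHAR('b)" and R: "R = CHAR('b) ^ k"
    and d: "d > 0" "of_nat d \<noteq> (0::'b)" and e: "R\<^sup>2 - 1 = d * e"
    and h: "h \<noteq> 0" "degree h = d - 1"
    and large: "R > w0\<^sup>2 + 3 * w0 + d" and w0: "w0 = (d - 1)\<^sup>2"
  shows "d * card {z. z ^ (R\<^sup>2) = z \<and> poly h z ^ e = 1} \<le> R\<^sup>2 + (2 * w0 + 1) * R"
proof -
  have Rpos: "R > 0" using large by simp
  have "\<forall>w. \<exists>i j. w \<ge> w0 \<longrightarrow> j < d \<and> w = d * i + (d - 1) * j"
    using weight_of_curve_monomial_exists[of d] d w0 by blast
  then obtain fi fj where fij: "\<And>w. w \<ge> w0 \<Longrightarrow> fj w < d \<and> w = d * fi w + (d - 1) * fj w"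
    by metis
  \<comment> \<open>\<open>v\<close> ranges up to \<open>R - 1\<close>, the largest value for which the weights \<open>v + R * u\<close> stay distinct;
    the excess \<open>2 * w0\<close> in the range of \<open>u\<close> compensates the \<open>w0\<close> missing weights in both ranges.\<close>
  define L where "L = R - 1"
  define S where "S = R + 2 * w0"
  define I where "I = {w0..S} \<times> {w0..L}"
  define D where "D = (L * R + S) div d"
  define J where "J = {..<d} \<times> {..D}"
  define clsE where "clsE = (\<lambda>(u, v). (R * fj v + fj u) mod d)"
  define clsG where "clsG = (\<lambda>(u, v). (fj v + R * fj u) mod d)"
  define ME where "ME = (\<lambda>(u, v). curve_monom h d (R * fi v + fi u) (R * fj v + fj u))"
  define MG where "MG = (\<lambda>(u, v). curve_monom h d (fi v + R * fi u) (fj v + R * fj u))"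
  have fin: "finite I" "finite J" by (simp_all add: I_def J_def)
  have I: "u \<ge> w0" "u \<le> S" "v \<ge> w0" "v \<le> L" if "(u, v) \<in> I" for u v
    using that by (auto simp: I_def)
  note cm = curve_monom[OF h(2,1) d(1)]
  have wtE: "d * degree (ME t) + (d - 1) * clsE t = R * snd t + fst t" if t: "t \<in> I" for t
  proof -
    obtain u v where uv: "t = (u, v)" by (cases t)
    note uv' = fij[OF I(1)] fij[OF I(3)]
    have "d * degree (ME t) + (d - 1) * clsE t =
       R * (d * fi v + (d - 1) * fj v) + (d * fi u + (d - 1) * fj u)"
      unfolding uv ME_def clsE_def prod.case cm(1) by (simp add: distrib_left mult_ac)
    thus ?thesis using uv'(1)[of u v] uv'(2)[of u v] t by (simp add: uv)
  qed
  have wtG: "d * degree (MG t) + (d - 1) * clsG t = snd t + R * fst t" if t: "t \<in> I" for t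
  proof -
    obtain u v where uv: "t = (u, v)" by (cases t)
    note uv' = fij[OF I(1)] fij[OF I(3)]
    have "d * degree (MG t) + (d - 1) * clsG t =
       (d * fi v + (d - 1) * fj v) + R * (d * fi u + (d - 1) * fj u)"
      unfolding uv MG_def clsG_def prod.case cm(1) by (simp add: distrib_left mult_ac)
    thus ?thesis using uv'(1)[of u v] uv'(2)[of u v] t by (simp add: uv)
  qed
  have "card J < card I"
  proof -
    have "d * D \<le> L * R + S" by (simp add: D_def)
    hence "card J \<le> L * R + S + d" by (simp add: J_def)
    also have "\<dots> = R\<^sup>2 + 2 * w0 + d"
      using Rpos by (cases R) (auto simp: L_def S_def power2_eq_square)
    also have "\<dots> < (R + w0 + 1) * (R - w0)"
    proof -
      have "w0 \<le> R" using large by simp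
      then obtain x where x: "R = w0 + x" using le_Suc_ex by blast
      show ?thesis using large unfolding x by (simp add: power2_eq_square algebra_simps)
    qed
    also have "\<dots> = card I"
    proof -
      have "card I = (S + 1 - w0) * (L + 1 - w0)" by (simp add: I_def card_cartesian_product)
      thus ?thesis using Rpos by (simp add: S_def L_def)
    qed
    finally show ?thesis .
  qed
  then obtain b where b: "\<exists>t\<in>I. b t \<noteq> 0"
      "\<forall>j\<in>J. (\<Sum>t\<in>I. b t * (if clsE t = fst j then coeff (ME t) (snd j) else 0)) = 0"
    using underdetermined_system_solution[OF fin(2,1),
        of "\<lambda>t j. if clsE t = fst j then coeff (ME t) (snd j) else 0"] by auto
  have "\<forall>t. \<exists>a. a ^ R = b t" using nth_root_exists[OF Rpos] by blast
  then obtain a where a: "\<And>t. a t ^ R = b t" by metis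
  define E where "E = (\<lambda>r. \<Sum>t\<in>{t\<in>I. clsE t = r}. smult (b t) (ME t))"
  define G where "G = (\<lambda>r. \<Sum>t\<in>{t\<in>I. clsG t = r}. smult (a t) (MG t))"
  \<comment> \<open>\<open>E r\<close> and \<open>G r\<close> are the coefficients of \<open>y^r\<close> in \<open>E\<close> and \<open>G\<close>.\<close>
  have E0: "E r = 0" if r: "r < d" for r
  proof (rule poly_eqI)
    fix n
    have cE: "coeff (E r) n = (\<Sum>t\<in>I. b t * (if clsE t = r then coeff (ME t) n else 0))"
      unfolding E_def using fin by (simp add: coeff_sum sum.If_cases if_distrib[of "\<lambda>x. _ * x"] Int_def cong: if_cong)
    show "coeff (E r) n = coeff 0 n"
    proof (cases "n \<le> D")
      case True
      thus ?thesis using bspec[OF b(2), of "(r, n)"] r by (simp add: J_def cE cong: if_cong)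
    next
      case False
      have "coeff (ME t) n = 0" if t: "t \<in> I" for t
      proof (rule coeff_eq_0)
        obtain u v where uv: "t = (u, v)" by (cases t)
        have "R * v + u \<le> L * R + S"
          using I(2,4)[of u v] t uv by (metis add_mono mult.commute mult_le_mono1)
        hence "d * degree (ME t) \<le> L * R + S" using wtE[OF t] uv by simp
        hence "degree (ME t) \<le> D" using d(1) by (simp add: D_def less_eq_div_iff_mult_less_eq mult.commute)
        thus "degree (ME t) < n" using False by simp
      qed
      thus ?thesis unfolding cE by (simp add: if_distrib[of "\<lambda>x. _ * x"] cong: if_cong)
    qed
  qed
  have vanish: "poly (G r) z = 0" if r: "r < d" and z: "z ^ (R\<^sup>2) = z" "poly h z ^ e = 1" for r z
  proof -
    have root: "(\<Sum>r<d. poly (G r) z * y ^ r) = 0" if y: "y ^ d = poly h z" for y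
    proof -
      have "y ^ (R\<^sup>2) = y"
      proof -
        have "y ^ (R\<^sup>2) = y * y ^ (R\<^sup>2 - 1)"
          using Rpos by (simp flip: power_Suc)
        also have "y ^ (R\<^sup>2 - 1) = 1" unfolding e power_mult y z(2) ..
        finally show ?thesis by simp
      qed
      note yR = this
      have grp: "(\<Sum>r<d. (\<Sum>t\<in>{t\<in>I. cls t = r}. f t) * y ^ r) = (\<Sum>t\<in>I. f t * y ^ cls t)"
        if "\<And>t. cls t < d" for cls :: "nat \<times> nat \<Rightarrow> nat" and f
      proof -
        have "(\<Sum>r<d. (\<Sum>t\<in>{t\<in>I. cls t = r}. f t) * y ^ r) =
              (\<Sum>r<d. \<Sum>t\<in>{t\<in>I. cls t = r}. f t * y ^ cls t)"
          by (rule sum.cong) (auto simp: sum_distrib_right intro!: sum.cong)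
        also have "\<dots> = (\<Sum>t\<in>I. f t * y ^ cls t)"
          by (rule sum.group) (use fin that in auto)
        finally show ?thesis .
      qed
      have clsE: "clsE t < d" and clsG: "clsG t < d" for t
        using d by (auto simp: clsE_def clsG_def split: prod.splits)
      have "(\<Sum>r<d. poly (G r) z * y ^ r) ^ R = (\<Sum>t\<in>I. a t * (poly (MG t) z * y ^ clsG t)) ^ R"
        using grp[OF clsG, of "\<lambda>t. a t * poly (MG t) z"] by (simp add: G_def poly_sum mult.assoc)
      also have "\<dots> = (\<Sum>t\<in>I. b t * (poly (MG t) z * y ^ clsG t) ^ R)"
        by (simp add: freshmans_dream_sum'[OF p R] power_mult_distrib a)
      also have "\<dots> = (\<Sum>t\<in>I. b t * (poly (ME t) z * y ^ clsE t))"
      proof (rule sum.cong[OF refl])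
        fix t assume "t \<in> I"
        obtain u v where uv: "t = (u, v)" by (cases t)
        have "(poly (MG t) z * y ^ clsG t) ^ R = (z ^ (fi v + R * fi u) * y ^ (fj v + R * fj u)) ^ R"
          unfolding uv MG_def clsG_def prod.case using cm(3)[OF y] by simp
        also have "\<dots> = z ^ (R * fi v) * (z ^ (R\<^sup>2)) ^ fi u * (y ^ (R * fj v) * (y ^ (R\<^sup>2)) ^ fj u)"
          by (simp add: power_mult_distrib power_add power2_eq_square mult_ac flip: power_mult)
        also have "\<dots> = z ^ (R * fi v + fi u) * y ^ (R * fj v + fj u)"
          unfolding yR z(1) by (simp add: power_add)
        also have "\<dots> = poly (ME t) z * y ^ clsE t"
          unfolding uv ME_def clsE_def prod.case using cm(3)[OF y] by simp
        finally show "b t * (poly (MG t) z * y ^ clsG t) ^ R = b t * (poly (ME t) z * y ^ clsE t)"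
          by simp
      qed
      also have "\<dots> = (\<Sum>r<d. poly (E r) z * y ^ r)"
        using grp[OF clsE, of "\<lambda>t. b t * poly (ME t) z"] by (simp add: E_def poly_sum mult.assoc)
      also have "\<dots> = 0" using E0 by simp
      finally show ?thesis using Rpos by simp
    qed
    define q where "q = (\<Sum>r<d. monom (poly (G r) z) r)"
    have qy: "poly q y = (\<Sum>r<d. poly (G r) z * y ^ r)" for y
      by (simp add: q_def poly_sum poly_monom)
    have cq: "coeff q n = (if n < d then poly (G n) z else 0)" for n
      by (simp add: q_def coeff_sum)
    have hz: "poly h z \<noteq> 0"
    proof
      assume "poly h z = 0"
      hence "e = 0" using z(2) by (simp add: power_0_left split: if_splits)
      moreover have "R > 1" using large d(1) by linarith
      hence "R\<^sup>2 > 1" by (rule one_less_power) simp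
      ultimately show False using e by simp
    qed
    have "q = 0"
    proof (rule ccontr)
      assume "q \<noteq> 0"
      have "d = card {y. y ^ d = poly h z}"
        using card_nth_roots(2)[OF d hz] by simp
      also have "\<dots> \<le> card {y. poly q y = 0}"
        using root poly_roots_finite[OF \<open>q \<noteq> 0\<close>] by (intro card_mono) (auto simp: qy)
      also have "\<dots> \<le> degree q" using card_poly_roots_bound[OF \<open>q \<noteq> 0\<close>] .
      finally have "coeff q (degree q) = 0" by (simp add: cq)
      thus False using \<open>q \<noteq> 0\<close> by simp
    qed
    thus ?thesis using cq[of r] r by simp
  qed
  have "\<exists>r<d. G r \<noteq> 0 \<and> d * degree (G r) \<le> L + R * S"
  proof -
    define wt where "wt = (\<lambda>t::nat \<times> nat. snd t + R * fst t)"
    have inj: "t = t'" if "t \<in> I" "t' \<in> I" "wt t = wt t'" for t t'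
    proof -
      have lt: "snd t < R" "snd t' < R" using that Rpos by (auto simp: I_def L_def)
      have "wt t mod R = wt t' mod R" "wt t div R = wt t' div R" using that by simp_all
      thus ?thesis using lt by (simp add: wt_def prod_eq_iff)
    qed
    define A where "A = {t\<in>I. a t \<noteq> 0}"
    have A: "finite A" "A \<noteq> {}"
    proof -
      show "finite A" using fin by (simp add: A_def)
      from b(1) obtain t where "t \<in> I" "b t \<noteq> 0" by auto
      hence "t \<in> A" using a[of t] Rpos by (auto simp: A_def power_0_left)
      thus "A \<noteq> {}" by auto
    qed
    have "Max (wt ` A) \<in> wt ` A" using A by (intro Max_in) auto
    then obtain t0 where "t0 \<in> A" "wt t0 = Max (wt ` A)" by auto
    hence t0: "t0 \<in> A" "\<And>t. t \<in> A \<Longrightarrow> wt t \<le> wt t0" using A by simp_all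
    have t0I: "t0 \<in> I" "a t0 \<noteq> 0" using t0 by (auto simp: A_def)
    define r where "r = clsG t0"
    define n where "n = degree (MG t0)"
    have less: "degree (MG t) < n" if "t \<in> A" "clsG t = r" "t \<noteq> t0" for t
    proof -
      have tI: "t \<in> I" using that by (simp add: A_def)
      have "wt t < wt t0" using t0(2)[OF that(1)] inj[OF tI t0I(1)] that(3) by (meson le_neq_implies_less)
      moreover have "d * degree (MG t) + (d - 1) * r = wt t"
        using wtG[OF tI] that(2) by (simp add: wt_def)
      moreover have "d * n + (d - 1) * r = wt t0"
        using wtG[OF t0I(1)] by (simp add: wt_def n_def r_def)
      ultimately have "d * degree (MG t) < d * n" by linarith
      thus ?thesis by simp
    qed
    have Gr: "G r = (\<Sum>t\<in>{t\<in>A. clsG t = r}. smult (a t) (MG t))"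
      unfolding G_def using fin by (intro sum.mono_neutral_right) (auto simp: A_def)
    have MG0: "MG t \<noteq> 0" for t by (cases t) (simp add: MG_def cm(2))
    have "coeff (G r) n = (\<Sum>t\<in>{t\<in>A. clsG t = r}. a t * coeff (MG t) n)"
      by (simp add: Gr coeff_sum)
    also have "\<dots> = (\<Sum>t\<in>{t0}. a t * coeff (MG t) n)"
      by (rule sum.mono_neutral_right) (use A t0 less in \<open>auto simp: r_def coeff_eq_0\<close>)
    also have "\<dots> \<noteq> 0" using t0I MG0[of t0] by (simp add: n_def)
    finally have "G r \<noteq> 0" by auto
    moreover have "degree (G r) \<le> n"
      unfolding Gr
    proof (rule degree_sum_le)
      fix t assume "t \<in> {t\<in>A. clsG t = r}"
      hence "degree (MG t) \<le> n" using less[of t] by (cases "t = t0") (auto simp: n_def)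
      thus "degree (smult (a t) (MG t)) \<le> n" using degree_smult_le[of "a t" "MG t"] by linarith
    qed (use A in auto)
    moreover have "d * n \<le> L + R * S"
    proof -
      have "d * n \<le> snd t0 + R * fst t0" using wtG[OF t0I(1)] by (simp add: n_def)
      also have "\<dots> \<le> L + R * S" using t0I(1) by (intro add_mono mult_left_mono) (auto simp: I_def)
      finally show ?thesis .
    qed
    moreover have "r < d" using d by (auto simp: r_def clsG_def split: prod.splits)
    ultimately show ?thesis by (metis mult_le_mono2 order_trans)
  qed
  then obtain r where r: "r < d" "G r \<noteq> 0" "d * degree (G r) \<le> L + R * S" by auto
  have "card {z. z ^ (R\<^sup>2) = z \<and> poly h z ^ e = 1} \<le> card {z. poly (G r) z = 0}"
    using vanish[OF r(1)] poly_roots_finite[OF r(2)] by (intro card_mono) auto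
  also have "\<dots> \<le> degree (G r)" by (rule card_poly_roots_bound[OF r(2)])
  finally have "d * card {z. z ^ (R\<^sup>2) = z \<and> poly h z ^ e = 1} \<le> L + R * S"
    using r(3) by (meson le_trans mult_le_mono2)
  also have "\<dots> \<le> R\<^sup>2 + (2 * w0 + 1) * R"
    by (simp add: L_def S_def power2_eq_square algebra_simps)
  finally show ?thesis .
qed

section \<open>Cubic character sums in a quadratic extension\<close>

text \<open>
  A character of the group of \<open>d\<close>-th roots of unity, extended by 0 so that the characters induced
  by it vanish at 0.
\<close>

definition root_char :: "nat \<Rightarrow> ('b::field \<Rightarrow> complex) \<Rightarrow> bool" where
  "root_char d \<Psi> \<longleftrightarrow> \<Psi> 0 = 0 \<and> (\<forall>z w. z ^ d = 1 \<longrightarrow> w ^ d = 1 \<longrightarrow> \<Psi> (z * w) = \<Psi> z * \<Psi> w) \<and>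
     (\<forall>z. z ^ d = 1 \<longrightarrow> norm (\<Psi> z) = 1)"

text \<open>
  The character of \<open>fixfield P\<close> that \<open>\<Psi>\<close> induces through the \<open>d\<close>-th power residue symbol. For
  varying \<open>P\<close> these characters arise from each other by composition with the norm.
\<close>

definition lift_char :: "nat \<Rightarrow> ('b::field \<Rightarrow> complex) \<Rightarrow> nat \<Rightarrow> 'b \<Rightarrow> complex" where
  "lift_char d \<Psi> P y = \<Psi> (y ^ ((P - 1) div d))"

definition cubic_sum :: "'b::field set \<Rightarrow> ('b \<Rightarrow> complex) \<Rightarrow> 'b \<Rightarrow> complex" where
  "cubic_sum K \<chi> c = (\<Sum>x\<in>K. \<chi> (x * (x + 1) * (x + c)))"

lemma fixfield_power_eq_1:
  assumes "y \<in> fixfield P" "y \<noteq> 0" "P > 0"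
  shows "y ^ (P - 1) = 1"
proof -
  have "y * y ^ (P - 1) = y * 1"
    using assms by (simp add: fixfield_def flip: power_Suc)
  thus ?thesis using assms(2) by (simp only: mult_cancel_left) simp
qed

lemma exponent_quotient:
  assumes "P > 1" "d dvd P - (1::nat)"
  shows "P - 1 = (P - 1) div d * d" "(P - 1) div d > 0" "d > 0"
proof -
  show *: "P - 1 = (P - 1) div d * d" using assms(2) by simp
  have "P - 1 > 0" using assms(1) by simp
  thus "(P - 1) div d > 0" "d > 0" using * by (metis mult_is_0 neq0_conv)+
qed

lemma char_on_lift_char:
  fixes \<Psi> :: "'b::field \<Rightarrow> complex"
  assumes \<Psi>: "root_char d \<Psi>" and P: "P > 1" "d dvd P - 1"
  shows "char_on (fixfield P) (lift_char d \<Psi> P)"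
proof -
  define e where "e = (P - 1) div d"
  have e: "P - 1 = e * d" "e > 0" using exponent_quotient[OF P] by (simp_all add: e_def)
  have root: "(y ^ e) ^ d = 1" if "y \<in> fixfield P" "y \<noteq> 0" for y :: 'b
    using fixfield_power_eq_1[OF that] P(1) by (simp only: power_mult[symmetric] e(1)[symmetric])
  have "\<Psi> ((x * y) ^ e) = \<Psi> (x ^ e) * \<Psi> (y ^ e)" if "x \<in> fixfield P" "y \<in> fixfield P" for x y
  proof (cases "x = 0 \<or> y = 0")
    case True
    thus ?thesis using \<Psi> e by (auto simp: root_char_def power_0_left)
  next
    case False
    thus ?thesis using \<Psi> root[OF that(1)] root[OF that(2)] by (auto simp: root_char_def power_mult_distrib)
  qed
  thus ?thesis using \<Psi> e(2) root
    unfolding char_on_def lift_char_def e_def[symmetric] by (auto simp: root_char_def power_0_left)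
qed

lemma char_on_power:
  assumes "char_on K \<chi>" "j > 0"
  shows "char_on K (\<lambda>x. \<chi> x ^ j)"
  using assms by (auto simp: char_on_def power_mult_distrib norm_power)

lemma sum_lift_char_power_eq_0:
  fixes \<Psi> :: "'b::alg_closed_field \<Rightarrow> complex"
  assumes \<Psi>: "root_char d \<Psi>" and P: "P > 1" "d dvd P - 1"
    and p: "prime CHAR('b)" "P = CHAR('b) ^ k"
    and z: "z ^ d = 1" "\<Psi> z ^ j \<noteq> 1" and j: "j > 0"
  shows "(\<Sum>x\<in>fixfield P. lift_char d \<Psi> P x ^ j) = 0"
proof -
  define e where "e = (P - 1) div d"
  have e: "P - 1 = e * d" "e > 0" using exponent_quotient[OF P] by (simp_all add: e_def)
  obtain y where y: "y ^ e = z" using nth_root_exists[OF e(2)] by blast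
  have "k > 0" using P(1) p(2) by (cases k) auto
  hence "of_nat P = (0::'b)" unfolding p(2) by simp
  hence fin: "finite (fixfield P :: 'b set)" using card_fixfield P(1) by blast
  have "y ^ P = y * y ^ (P - 1)" using P(1) by (simp flip: power_Suc)
  also have "y ^ (P - 1) = 1" using y z by (simp only: e(1) power_mult)
  finally have "y ^ P = y" by simp
  have "z \<noteq> 0" using z P e by (auto simp: power_0_left split: if_splits)
  hence "y \<noteq> 0" using y e(2) by auto
  with \<open>y ^ P = y\<close> show ?thesis
    using sum_char_on_eq_0[OF char_on_power[OF char_on_lift_char[OF \<Psi> P] j] is_subfield_fixfield[OF p] fin, of y]
      z(2) y by (simp only: lift_char_def e_def[symmetric]) (simp add: fixfield_def)
qed

lemma lift_char_square:
  assumes "P > 0" "d dvd P - 1"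
  shows "lift_char d \<Psi> (P\<^sup>2) y = lift_char d \<Psi> P (y * y ^ P)"
proof -
  have "(P\<^sup>2 - 1) div d = (Suc P) * ((P - 1) div d)"
  proof -
    have "P\<^sup>2 - 1 = Suc P * (P - 1)"
      using assms(1) by (cases P) (auto simp: power2_eq_square)
    thus ?thesis using div_mult_swap[OF assms(2)] by metis
  qed
  thus ?thesis by (simp only: lift_char_def power_mult power_Suc)
qed

lemma roots_of_monic_quadratic:
  fixes r1 r2 :: "'b::field"
  shows "x + y = r1 + r2 \<and> x * y = r1 * r2 \<longleftrightarrow> x = r1 \<and> y = r2 \<or> x = r2 \<and> y = r1"
proof
  assume *: "x + y = r1 + r2 \<and> x * y = r1 * r2"
  hence y: "y = r1 + r2 - x" by (metis add_diff_cancel_left')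
  hence "x * (r1 + r2 - x) = r1 * r2" using * by simp
  hence "(x - r1) * (x - r2) = 0" by (simp add: algebra_simps)
  thus "x = r1 \<and> y = r2 \<or> x = r2 \<and> y = r1" using y by auto
qed (auto simp: algebra_simps)

text \<open>
  A monic quadratic polynomial over the field with \<open>P\<close> elements either is irreducible, and then
  comes from exactly two elements of the quadratic extension and from no pair of roots in the
  base field, or it splits. Two distinct roots give two ordered pairs; a double root gives one
  pair and one element \<open>x\<close> with \<open>x^P = x\<close>. In every case \<open>(s, n)\<close> is hit twice.
\<close>

lemma sum_over_quadratic_polynomials:
  fixes f :: "'b::alg_closed_field \<Rightarrow> 'b \<Rightarrow> complex"
  assumes p: "prime CHAR('b)" "P = CHAR('b) ^ k" "k > 0"
  shows "(\<Sum>x\<in>fixfield (P\<^sup>2). f (x + x ^ P) (x * x ^ P)) +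
         (\<Sum>x\<in>fixfield P. \<Sum>y\<in>fixfield P. f (x + y) (x * y)) =
         2 * (\<Sum>s\<in>fixfield P. \<Sum>n\<in>fixfield P. f s n)"
proof -
  define K where "K = (fixfield P :: 'b set)"
  define K2 where "K2 = (fixfield (P\<^sup>2) :: 'b set)"
  have P1: "P > 1" unfolding p(2) by (rule one_less_power[OF prime_gt_1_nat[OF p(1)] p(3)])
  have "P\<^sup>2 > 1" using P1 by (rule one_less_power) simp
  hence fin: "finite K" "finite K2"
    unfolding K_def K2_def using p(2,3) P1 by (auto intro!: card_fixfield(1))
  have sub: "is_subfield K" unfolding K_def by (rule is_subfield_fixfield[OF p(1,2)])
  note K = is_subfieldD[OF sub]
  have frob: "(x + y) ^ P = x ^ P + y ^ P" for x y :: 'b by (rule freshmans_dream'[OF p(1,2)])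
  have KI: "x \<in> K \<longleftrightarrow> x ^ P = x" for x by (simp add: K_def fixfield_def)
  have K2I: "x \<in> K2 \<longleftrightarrow> (x ^ P) ^ P = x" for x
    by (simp add: K2_def fixfield_def power2_eq_square flip: power_mult)
  define tn where "tn = (\<lambda>x::'b. (x + x ^ P, x * x ^ P))"
  define sp where "sp = (\<lambda>(x::'b, y). (x + y, x * y))"
  have tn: "tn ` K2 \<subseteq> K \<times> K"
    by (auto simp: tn_def KI K2I frob power_mult_distrib add.commute mult.commute)
  have sp: "sp ` (K \<times> K) \<subseteq> K \<times> K" using K by (auto simp: sp_def)
  have count: "card {x \<in> K2. tn x = (s, n)} + card {t \<in> K \<times> K. sp t = (s, n)} = 2"
    if sn: "s \<in> K" "n \<in> K" for s n
  proof -
    obtain r1 where r1: "poly [:n, - s, 1:] r1 = 0"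
      using alg_closed_imp_poly_has_root[of "[:n, - s, 1:]"] by auto
    define r2 where "r2 = s - r1"
    have s: "s = r1 + r2" and n: "n = r1 * r2"
      using r1 by (auto simp: r2_def algebra_simps add_eq_0_iff)
    have A: "{x \<in> K2. tn x = (s, n)} = {x \<in> K2. x = r1 \<and> x ^ P = r2 \<or> x = r2 \<and> x ^ P = r1}"
      unfolding tn_def s n prod.inject roots_of_monic_quadratic ..
    have B: "{t \<in> K \<times> K. sp t = (s, n)} = {t \<in> K \<times> K. t = (r1, r2) \<or> t = (r2, r1)}"
      unfolding sp_def s n
      by (intro Collect_cong conj_cong refl) (auto simp: roots_of_monic_quadratic split: prod.splits)
    show ?thesis
    proof (cases "r1 \<in> K")
      case True
      hence r2K: "r2 \<in> K" using K sn by (auto simp: r2_def)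
      have B': "{t \<in> K \<times> K. sp t = (s, n)} = {(r1, r2), (r2, r1)}" unfolding B using True r2K by auto
      have A': "{x \<in> K2. tn x = (s, n)} = (if r1 = r2 then {r1} else {})"
        unfolding A using True r2K by (auto simp: KI K2I)
      show ?thesis unfolding A' B' by simp
    next
      case False
      hence r2K: "r2 \<notin> K" using K(3)[OF sn(1), of r2] s by auto
      have flip: "x ^ P + (s - x) ^ P = r1 + r2 \<and> x ^ P * (s - x) ^ P = r1 * r2"
        if "x * (s - x) = n" for x
        using that sn frob[of x "s - x"] by (simp add: KI s n flip: power_mult_distrib)
      have "r1 ^ P = r2 \<and> r2 ^ P = r1"
        using flip[of r1] False r2K unfolding roots_of_monic_quadratic by (auto simp: KI s n)
      moreover from this False have "r1 \<noteq> r2" by (auto simp: KI)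
      ultimately have A': "{x \<in> K2. tn x = (s, n)} = {r1, r2}"
        unfolding A by (auto simp: K2I)
      have B': "{t \<in> K \<times> K. sp t = (s, n)} = {}" unfolding B using False r2K by auto
      show ?thesis unfolding A' B' using \<open>r1 \<noteq> r2\<close> by simp
    qed
  qed
  have "(\<Sum>x\<in>K2. f (x + x ^ P) (x * x ^ P)) = (\<Sum>x\<in>K2. case_prod f (tn x))"
    by (simp add: tn_def)
  also have "\<dots> = (\<Sum>t\<in>K\<times>K. \<Sum>x\<in>{x\<in>K2. tn x = t}. case_prod f (tn x))"
    by (rule sum.group[symmetric]) (use fin tn in auto)
  also have "\<dots> = (\<Sum>t\<in>K\<times>K. of_nat (card {x\<in>K2. tn x = t}) * case_prod f t)"
    by (rule sum.cong) auto
  finally have 1: "(\<Sum>x\<in>K2. f (x + x ^ P) (x * x ^ P)) = \<dots>" .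
  have "(\<Sum>x\<in>K. \<Sum>y\<in>K. f (x + y) (x * y)) = (\<Sum>t\<in>K\<times>K. case_prod f (sp t))"
    by (simp add: sp_def sum.cartesian_product case_prod_unfold)
  also have "\<dots> = (\<Sum>t\<in>K\<times>K. \<Sum>x\<in>{x\<in>K\<times>K. sp x = t}. case_prod f (sp x))"
    by (rule sum.group[symmetric]) (use fin sp in auto)
  also have "\<dots> = (\<Sum>t\<in>K\<times>K. of_nat (card {x\<in>K\<times>K. sp x = t}) * case_prod f t)"
    by (rule sum.cong) auto
  finally have 2: "(\<Sum>x\<in>K. \<Sum>y\<in>K. f (x + y) (x * y)) = \<dots>" .
  have "(\<Sum>x\<in>K2. f (x + x ^ P) (x * x ^ P)) + (\<Sum>x\<in>K. \<Sum>y\<in>K. f (x + y) (x * y)) =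
     (\<Sum>t\<in>K\<times>K. of_nat (card {x\<in>K2. tn x = t} + card {x\<in>K\<times>K. sp x = t}) * case_prod f t)"
    unfolding 1 2 by (simp add: sum.distrib distrib_right)
  also have "\<dots> = (\<Sum>t\<in>K\<times>K. 2 * case_prod f t)"
  proof (rule sum.cong[OF refl])
    fix t assume "t \<in> K \<times> K"
    hence "card {x\<in>K2. tn x = t} + card {x\<in>K\<times>K. sp x = t} = 2"
      using count[of "fst t" "snd t"] by auto
    thus "of_nat (card {x\<in>K2. tn x = t} + card {x\<in>K\<times>K. sp x = t}) * case_prod f t = 2 * case_prod f t"
      by simp
  qed
  also have "\<dots> = 2 * (\<Sum>s\<in>K. \<Sum>n\<in>K. f s n)"
    by (simp add: sum_distrib_left sum.cartesian_product case_prod_unfold)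
  finally show ?thesis unfolding K_def K2_def .
qed

text \<open>
  The argument of \<open>\<chi>\<close> is the product of the values of \<open>X^2 - s X + n\<close> at the points
  \<open>0, -1, -c\<close>. These are three linear forms in \<open>(s, n)\<close>; scaling the first two so that the third
  becomes proportional to \<open>1 - u - v\<close> gives a double Jacobi sum that does not depend on \<open>c\<close>.
\<close>

lemma norm_quadratic_char_sum:
  fixes \<chi> :: "'b::field \<Rightarrow> complex"
  assumes \<chi>: "char_on K \<chi>" and sub: "is_subfield K" and c: "c \<in> K" "c \<noteq> 0" "c \<noteq> 1"
  shows "norm (\<Sum>s\<in>K. \<Sum>n\<in>K. \<chi> (n * (1 + s + n) * (c\<^sup>2 + c * s + n))) =
         norm (\<Sum>u\<in>K. \<Sum>v\<in>K. \<chi> (u * v * (1 - u - v)))"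
proof -
  note K = is_subfieldD[OF sub]
  define a where "a = - ((c * (1 - c)) ^ 2)"
  have a: "a \<in> K" "a \<noteq> 0" using K c by (auto simp: a_def)
  have "(\<Sum>s\<in>K. \<Sum>n\<in>K. \<chi> (n * (1 + s + n) * (c\<^sup>2 + c * s + n))) =
        (\<Sum>n\<in>K. \<Sum>s\<in>K. \<chi> (n * (1 + s + n) * (c\<^sup>2 + c * s + n)))"
    by (rule sum.swap)
  also have "\<dots> = (\<Sum>u\<in>K. \<Sum>s\<in>K. \<chi> (c * u * (1 + s + c * u) * (c\<^sup>2 + c * s + c * u)))"
    by (rule sum.reindex_bij_witness[of _ "\<lambda>u. c * u" "\<lambda>n. n / c"]) (use K c in auto)
  also have "\<dots> = (\<Sum>u\<in>K. \<Sum>v\<in>K. \<chi> (a * (u * v * (1 - u - v))))"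
  proof (rule sum.cong[OF refl])
    fix u assume u: "u \<in> K"
    show "(\<Sum>s\<in>K. \<chi> (c * u * (1 + s + c * u) * (c\<^sup>2 + c * s + c * u))) =
          (\<Sum>v\<in>K. \<chi> (a * (u * v * (1 - u - v))))"
    proof (rule sum.reindex_bij_witness[of _ "\<lambda>v. (1 - c) * v - 1 - c * u" "\<lambda>s. (1 + s + c * u) / (1 - c)"])
      fix s assume "s \<in> K"
      have ne: "1 - c \<noteq> 0" using c by simp
      define v where "v = (1 + s + c * u) / (1 - c)"
      have s: "s = (1 - c) * v - 1 - c * u" using ne by (simp add: v_def)
      have "a * (u * v * (1 - u - v)) = c * u * (1 + s + c * u) * (c\<^sup>2 + c * s + c * u)"
        unfolding s a_def by (simp add: algebra_simps power2_eq_square)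
      thus "\<chi> (a * (u * ((1 + s + c * u) / (1 - c)) * (1 - u - (1 + s + c * u) / (1 - c)))) =
          \<chi> (c * u * (1 + s + c * u) * (c\<^sup>2 + c * s + c * u))"
        unfolding v_def by simp
    qed (use K c u in auto)
  qed
  also have "\<dots> = (\<Sum>u\<in>K. \<Sum>v\<in>K. \<chi> a * \<chi> (u * v * (1 - u - v)))"
    by (intro sum.cong refl char_on_simps(2)[OF \<chi>] a K)
  also have "\<dots> = \<chi> a * (\<Sum>u\<in>K. \<Sum>v\<in>K. \<chi> (u * v * (1 - u - v)))"
    by (simp add: sum_distrib_left)
  finally show ?thesis using char_on_simps(3)[OF \<chi> a] by (simp add: norm_mult)
qed

text \<open>
  This is the second Newton identity for the L-function \<open>1 + S t + a t^2\<close> of the cubic sum: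
  the sum over the quadratic extension equals \<open>2 a - S^2\<close>, where \<open>a\<close> is a character sum over all monic
  quadratic polynomials, and its absolute value is given by Jacobi sums.
\<close>

lemma norm_cubic_sum_square_le_quadratic_extension:
  fixes \<Psi> :: "'b::alg_closed_field \<Rightarrow> complex"
  assumes \<Psi>: "root_char d \<Psi>" and P: "P > 1" "d dvd P - 1"
    and p: "prime CHAR('b)" "P = CHAR('b) ^ k"
    and w: "w ^ d = 1" "\<Psi> w ^ 2 \<noteq> 1"
    and c: "c \<in> fixfield P" "c \<noteq> 0" "c \<noteq> 1"
  shows "\<exists>a. norm (cubic_sum (fixfield P) (lift_char d \<Psi> P) c) ^ 2 \<le>
           norm (cubic_sum (fixfield (P\<^sup>2)) (lift_char d \<Psi> (P\<^sup>2)) c) + 2 * a \<and> a \<ge> 0 \<and>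
           complex_of_real (a\<^sup>2) = of_nat P * (of_nat P - (\<Sum>x\<in>fixfield P. lift_char d \<Psi> P x ^ 3))"
proof -
  define K where "K = (fixfield P :: 'b set)"
  define \<chi> where "\<chi> = lift_char d \<Psi> P"
  have k: "k > 0" using P(1) p(2) by (cases k) auto
  have "of_nat P = (0::'b)" unfolding p(2) using k by simp
  hence fin: "finite K" "card K = P" using card_fixfield P(1) unfolding K_def by blast+
  have sub: "is_subfield K" unfolding K_def by (rule is_subfield_fixfield[OF p(1,2)])
  note K = is_subfieldD[OF sub]
  have ch: "char_on K \<chi>" unfolding K_def \<chi>_def by (rule char_on_lift_char[OF \<Psi> P])
  note \<chi> = char_on_simps[OF ch]
  have w1: "\<Psi> w \<noteq> 1" using w(2) by auto
  have s1: "(\<Sum>x\<in>K. \<chi> x) = 0"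
    using sum_lift_char_power_eq_0[OF \<Psi> P p w(1), of 1] w1 by (simp add: K_def \<chi>_def)
  have s2: "(\<Sum>x\<in>K. \<chi> x ^ 2) = 0"
    using sum_lift_char_power_eq_0[OF \<Psi> P p w(1), of 2] w(2) by (simp add: K_def \<chi>_def)
  have frob: "(x + y) ^ P = x ^ P + y ^ P" for x y :: 'b by (rule freshmans_dream'[OF p])
  have cK: "c \<in> K" "c ^ P = c" using c by (auto simp: K_def fixfield_def)
  define f where "f = (\<lambda>s n. \<chi> (n * (1 + s + n) * (c\<^sup>2 + c * s + n)))"
  define S where "S = cubic_sum K \<chi> c"
  define S' where "S' = cubic_sum (fixfield (P\<^sup>2)) (lift_char d \<Psi> (P\<^sup>2)) c"
  have resultant: "n * (1 + s + n) * (c\<^sup>2 + c * s + n) = (x * (x + 1) * (x + c)) * (y * (y + 1) * (y + c))"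
    if "s = x + y" "n = x * y" for s n x y
    unfolding that by (simp add: algebra_simps power2_eq_square)
  have "S' = (\<Sum>x\<in>fixfield (P\<^sup>2). f (x + x ^ P) (x * x ^ P))"
    unfolding S'_def cubic_sum_def
  proof (rule sum.cong[OF refl])
    fix x :: 'b
    have "(x * (x + 1) * (x + c)) ^ P = x ^ P * (x ^ P + 1) * (x ^ P + c)"
      by (simp add: power_mult_distrib frob cK)
    hence "lift_char d \<Psi> (P\<^sup>2) (x * (x + 1) * (x + c)) =
        \<chi> ((x * (x + 1) * (x + c)) * (x ^ P * (x ^ P + 1) * (x ^ P + c)))"
      using P by (simp add: lift_char_square \<chi>_def)
    thus "lift_char d \<Psi> (P\<^sup>2) (x * (x + 1) * (x + c)) = f (x + x ^ P) (x * x ^ P)"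
      unfolding f_def resultant[OF refl refl] .
  qed
  moreover have "S * S = (\<Sum>x\<in>K. \<Sum>y\<in>K. f (x + y) (x * y))"
    unfolding S_def cubic_sum_def sum_product
  proof (intro sum.cong refl)
    fix x y assume "x \<in> K" "y \<in> K"
    thus "\<chi> (x * (x + 1) * (x + c)) * \<chi> (y * (y + 1) * (y + c)) = f (x + y) (x * y)"
      unfolding f_def resultant[OF refl refl] using K cK by (subst (3) \<chi>(2)) simp_all
  qed
  ultimately have eq: "S' + S * S = 2 * (\<Sum>s\<in>K. \<Sum>n\<in>K. f s n)"
    using sum_over_quadratic_polynomials[OF p k, of f] by (simp add: K_def)
  define a where "a = norm (\<Sum>s\<in>K. \<Sum>n\<in>K. f s n)"
  have "S * S = 2 * (\<Sum>s\<in>K. \<Sum>n\<in>K. f s n) - S'" using eq by (simp add: algebra_simps)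
  hence "norm S ^ 2 = norm (2 * (\<Sum>s\<in>K. \<Sum>n\<in>K. f s n) - S')"
    by (metis norm_mult power2_eq_square)
  also have "\<dots> \<le> 2 * a + norm S'"
    unfolding a_def using norm_triangle_ineq4 by (metis norm_mult norm_numeral)
  finally have "norm S ^ 2 \<le> norm S' + 2 * a" by simp
  moreover have "complex_of_real (a\<^sup>2) = of_nat P * (of_nat P - (\<Sum>x\<in>K. \<chi> x ^ 3))"
    unfolding a_def f_def norm_quadratic_char_sum[OF ch sub cK(1) c(2,3)]
    using norm_double_jacobi_sum[OF ch sub fin(1) s1 s2] fin(2) by simp
  moreover have "a \<ge> 0" by (simp add: a_def)
  ultimately show ?thesis unfolding S_def S'_def K_def \<chi>_def by blast
qed

section \<open>The Weil bound for cubic character sums\<close>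

text \<open>
  The substitution \<open>z = 1/x\<close> moves the branch point \<open>x = 0\<close> to infinity. The right-hand side
  becomes \<open>z^(d-3) (1 + z) (1 + c z)\<close>, of degree \<open>d - 1\<close> and hence coprime to \<open>d\<close>, which leaves a
  single point at infinity even if 3 divides \<open>d\<close>.
\<close>

lemma poly_reversed_cubic:
  fixes x c \<gamma> :: "'b::field"
  assumes "d \<ge> 3" "x \<noteq> 0"
  shows "poly (smult \<gamma> (monom 1 (d - 3) * ([:1, 1:] * [:1, c:]))) (inverse x) =
         \<gamma> * (inverse x ^ d * (x * (x + 1) * (x + c)))"
proof -
  define z where "z = inverse x"
  have xz: "z * x = 1" using assms by (simp add: z_def)
  have "z ^ d = z ^ (d - 3) * (z * (z * z))"
    using assms(1) by (metis le_add_diff_inverse2 power_add power3_eq_cube mult.assoc)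
  hence "z ^ d * (x * (x + 1) * (x + c)) = z ^ (d - 3) * ((z * x) * (z * x + z) * (z * x + c * z))"
    by (simp add: algebra_simps)
  also have "\<dots> = z ^ (d - 3) * ((1 + z) * (1 + c * z))" unfolding xz by simp
  finally have "z ^ d * (x * (x + 1) * (x + c)) = z ^ (d - 3) * ((1 + z) * (1 + c * z))" .
  moreover have "poly (smult \<gamma> (monom 1 (d - 3) * ([:1, 1:] * [:1, c:]))) z =
      \<gamma> * (z ^ (d - 3) * ((1 + z) * (1 + c * z)))"
    by (simp only: poly_smult poly_mult poly_monom poly_pCons poly_0) (simp add: mult.commute)
  ultimately show ?thesis by (simp only: z_def[symmetric])
qed

text \<open>
  Multiplying the right-hand side by a suitable \<open>\<gamma>\<close> reduces the power residue class of \<open>\<zeta>\<close> to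
  that of 1.
\<close>

lemma card_cubic_power_residue_le:
  fixes c \<zeta> :: "'b::alg_closed_field"
  assumes p: "prime CHAR('b)" and R: "R = CHAR('b) ^ k"
    and d: "d \<ge> 3" "of_nat d \<noteq> (0::'b)" and e: "R\<^sup>2 - 1 = d * e" "e > 0"
    and large: "R > w0\<^sup>2 + 3 * w0 + d" and w0: "w0 = (d - 1)\<^sup>2"
    and c: "c \<noteq> 0" and \<zeta>: "\<zeta> ^ d = 1"
  shows "d * card {x \<in> fixfield (R\<^sup>2). (x * (x + 1) * (x + c)) ^ e = \<zeta>} \<le> R\<^sup>2 + (2 * w0 + 1) * R"
proof -
  have \<zeta>0: "\<zeta> \<noteq> 0" using \<zeta> d by (auto simp: power_0_left)
  obtain \<gamma> where \<gamma>: "\<gamma> ^ e = inverse \<zeta>" using nth_root_exists[OF e(2)] by blast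
  have \<gamma>0: "\<gamma> \<noteq> 0" using \<gamma> \<zeta>0 e(2) by (auto simp: power_0_left)
  define h where "h = smult \<gamma> (monom 1 (d - 3) * ([:1, 1:] * [:1, c:]))"
  have h0: "h \<noteq> 0" using \<gamma>0 unfolding h_def by (simp del: mult_pCons_left mult_pCons_right)
  have "degree ([:1, 1:] * [:1, c:]) = 2" using c by (subst degree_mult_eq) auto
  hence "degree h = d - 1"
    unfolding h_def using \<gamma>0 d(1)
    by (simp only: degree_smult_eq if_False, subst degree_mult_eq) (auto simp: degree_monom_eq)
  note bound = card_power_residue_values_le[OF p R _ d(2) e(1) h0 this large w0]
  have "card {x \<in> fixfield (R\<^sup>2). (x * (x + 1) * (x + c)) ^ e = \<zeta>} \<le>
        card {z. z ^ (R\<^sup>2) = z \<and> poly h z ^ e = 1}"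
  proof (rule card_inj_on_le[of inverse])
    show "finite {z. z ^ (R\<^sup>2) = z \<and> poly h z ^ e = 1}"
    proof (rule finite_subset)
      have "R > 1" using large d by linarith
      hence k: "k > 0" using R by (cases k) auto
      have "R\<^sup>2 > 1" using \<open>R > 1\<close> by (rule one_less_power) simp
      thus "finite (fixfield (R\<^sup>2) :: 'b set)" using R k by (intro card_fixfield) simp_all
    qed (auto simp: fixfield_def)
    show "inverse ` {x \<in> fixfield (R\<^sup>2). (x * (x + 1) * (x + c)) ^ e = \<zeta>} \<subseteq>
          {z. z ^ (R\<^sup>2) = z \<and> poly h z ^ e = 1}"
    proof safe
      fix x assume x: "x \<in> fixfield (R\<^sup>2)" "\<zeta> = (x * (x + 1) * (x + c)) ^ e"
      have x0: "x \<noteq> 0" using x(2) \<zeta>0 e(2) by (auto simp: power_0_left)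
      show "inverse x ^ (R\<^sup>2) = inverse x" using x(1) by (simp add: fixfield_def power_inverse)
      have "R > 0" using large by linarith
      hence "x ^ (d * e) = 1" using fixfield_power_eq_1[OF x(1) x0] e(1) by simp
      thus "poly h (inverse x) ^ e = 1"
      proof -
        have "poly h (inverse x) ^ e = \<gamma> ^ e * ((inverse x ^ d) ^ e * (x * (x + 1) * (x + c)) ^ e)"
          unfolding h_def poly_reversed_cubic[OF d(1) x0] by (simp only: power_mult_distrib)
        also have "(inverse x ^ d) ^ e = 1"
          using \<open>x ^ (d * e) = 1\<close> by (simp add: power_inverse flip: power_mult)
        finally show ?thesis unfolding \<gamma> x(2)[symmetric] using \<zeta>0 by simp
      qed
    qed
  qed (auto simp: inj_on_def)
  hence "d * card {x \<in> fixfield (R\<^sup>2). (x * (x + 1) * (x + c)) ^ e = \<zeta>} \<le>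
      d * card {z. z ^ (R\<^sup>2) = z \<and> poly h z ^ e = 1}" by (rule mult_le_mono2)
  also have "\<dots> \<le> R\<^sup>2 + (2 * w0 + 1) * R" using bound d by simp
  finally show ?thesis .
qed

text \<open>
  The upper bounds for the power residue classes add up to little more than the size of the field,
  so no class can be much smaller than its bound either: since the values of a nontrivial character
  sum to zero, subtracting the common bound from all class sizes does not change the sum.
\<close>

lemma norm_cubic_sum_bounded:
  fixes \<Psi> :: "'b::alg_closed_field \<Rightarrow> complex"
  assumes \<Psi>: "root_char d \<Psi>" and p: "prime CHAR('b)" and R: "R = CHAR('b) ^ k"
    and d: "d \<ge> 3" "of_nat d \<noteq> (0::'b)" "d dvd R\<^sup>2 - 1"
    and large: "R > w0\<^sup>2 + 3 * w0 + d" and w0: "w0 = (d - 1)\<^sup>2"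
    and z: "z ^ d = 1" "\<Psi> z \<noteq> 1" and c: "c \<in> fixfield (R\<^sup>2)" "c \<noteq> 0"
  shows "norm (cubic_sum (fixfield (R\<^sup>2)) (lift_char d \<Psi> (R\<^sup>2)) c) \<le> real ((2 * w0 + 1) * R + 3)"
proof -
  define K where "K = (fixfield (R\<^sup>2) :: 'b set)"
  define g where "g = (\<lambda>x. x * (x + 1) * (x + c))"
  define e where "e = (R\<^sup>2 - 1) div d"
  have R1: "R > 1" using large d by linarith
  hence P1: "R\<^sup>2 > 1" by (rule one_less_power) simp
  have k: "k > 0" using R R1 by (cases k) auto
  have e: "R\<^sup>2 - 1 = d * e" "e > 0"
    using exponent_quotient[OF P1 d(3)] by (simp_all add: e_def mult.commute)
  have P: "R\<^sup>2 = CHAR('b) ^ (2 * k)" using R by (simp add: power_mult mult.commute)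
  have "of_nat (R\<^sup>2) = (0::'b)" using R k by simp
  hence K: "finite K" "card K = R\<^sup>2" using card_fixfield[OF P1] unfolding K_def by blast+
  have sub: "is_subfield K" unfolding K_def by (rule is_subfield_fixfield[OF p P])
  define U where "U = {u::'b. u ^ d = 1}"
  have U: "finite U" "card U = d"
    using card_nth_roots[of d "1::'b"] d by (simp_all add: U_def)
  have sumU: "(\<Sum>u\<in>U. \<Psi> u) = 0"
  proof -
    have z0: "z \<noteq> 0" using z d by (auto simp: power_0_left)
    have "(\<Sum>u\<in>U. \<Psi> u) = (\<Sum>u\<in>U. \<Psi> (z * u))"
      by (rule sum.reindex_bij_witness[of _ "\<lambda>u. z * u" "\<lambda>u. u / z"])
         (use z z0 in \<open>auto simp: U_def power_mult_distrib power_divide\<close>)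
    also have "\<dots> = \<Psi> z * (\<Sum>u\<in>U. \<Psi> u)"
      unfolding sum_distrib_left using \<Psi> z by (intro sum.cong) (auto simp: root_char_def U_def)
    finally show ?thesis using z(2) by simp
  qed
  define K' where "K' = {x \<in> K. g x \<noteq> 0}"
  define n where "n = (\<lambda>u. card {x \<in> K'. g x ^ e = u})"
  have fin': "finite K'" using K by (simp add: K'_def)
  have img: "(\<lambda>x. g x ^ e) ` K' \<subseteq> U"
  proof safe
    fix x assume x: "x \<in> K'"
    have "g x \<in> K" using x is_subfieldD[OF sub] c by (auto simp: K'_def g_def K_def)
    hence "g x ^ (R\<^sup>2 - 1) = 1" using x R1 by (intro fixfield_power_eq_1) (auto simp: K'_def K_def)
    hence "(g x ^ e) ^ d = 1" unfolding e(1) by (simp only: power_mult[symmetric] mult.commute)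
    thus "g x ^ e \<in> U" by (simp add: U_def)
  qed
  have grp: "(\<Sum>u\<in>U. \<Sum>x\<in>{x \<in> K'. g x ^ e = u}. F x) = (\<Sum>x\<in>K'. F x)" for F :: "'b \<Rightarrow> complex"
    by (rule sum.group) (use fin' U img in auto)
  have "cubic_sum K (lift_char d \<Psi> (R\<^sup>2)) c = (\<Sum>x\<in>K. \<Psi> (g x ^ e))"
    by (simp add: cubic_sum_def lift_char_def g_def e_def)
  also have "\<dots> = (\<Sum>x\<in>K'. \<Psi> (g x ^ e))"
    using K \<Psi> e(2) by (intro sum.mono_neutral_right) (auto simp: K'_def root_char_def power_0_left)
  also have "\<dots> = (\<Sum>u\<in>U. \<Sum>x\<in>{x \<in> K'. g x ^ e = u}. \<Psi> (g x ^ e))" by (rule grp[symmetric])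
  also have "\<dots> = (\<Sum>u\<in>U. of_nat (n u) * \<Psi> u)" by (simp add: n_def)
  finally have S: "cubic_sum K (lift_char d \<Psi> (R\<^sup>2)) c = (\<Sum>u\<in>U. of_nat (n u) * \<Psi> u)" .
  have sum_n: "(\<Sum>u\<in>U. n u) = card K'"
  proof -
    have "complex_of_nat (\<Sum>u\<in>U. n u) = of_nat (card K')" using grp[of "\<lambda>_. 1"] by (simp add: n_def)
    thus ?thesis by (simp only: of_nat_eq_iff)
  qed
  have "R\<^sup>2 \<le> card K' + 3"
  proof -
    have "K \<subseteq> K' \<union> {0, -1, -c}" by (auto simp: K'_def g_def add_eq_0_iff2)
    hence "card K \<le> card (K' \<union> {0, -1, -c})" using fin' by (intro card_mono) auto
    also have "\<dots> \<le> card K' + card {0, -1, -c}" by (rule card_Un_le)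
    also have "card {0, -1, -c} \<le> 3" by (simp add: card_insert_if)
    finally show ?thesis using K by simp
  qed
  define B where "B = real (R\<^sup>2 + (2 * w0 + 1) * R) / real d"
  have nB: "real (n u) \<le> B" if "u \<in> U" for u
  proof -
    have u: "u ^ d = 1" using that by (simp add: U_def)
    have "{x \<in> K'. g x ^ e = u} \<subseteq> {x \<in> fixfield (R\<^sup>2). (x * (x + 1) * (x + c)) ^ e = u}"
      by (auto simp: K'_def K_def g_def)
    hence "n u \<le> card {x \<in> fixfield (R\<^sup>2). (x * (x + 1) * (x + c)) ^ e = u}"
      unfolding n_def using K(1) by (intro card_mono) (auto simp: K_def)
    hence "d * n u \<le> R\<^sup>2 + (2 * w0 + 1) * R"
      using card_cubic_power_residue_le[OF p R d(1,2) e large w0 c(2) u] mult_le_mono2 le_trans by blast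
    hence "real (d * n u) \<le> real (R\<^sup>2 + (2 * w0 + 1) * R)" by (simp only: of_nat_le_iff)
    thus ?thesis unfolding B_def using d(1) by (simp add: field_simps)
  qed
  have "cubic_sum K (lift_char d \<Psi> (R\<^sup>2)) c = (\<Sum>u\<in>U. (of_nat (n u) - of_real B) * \<Psi> u)"
    using sumU by (simp add: S left_diff_distrib sum_subtractf flip: sum_distrib_left)
  also have "norm \<dots> \<le> (\<Sum>u\<in>U. B - real (n u))"
  proof (rule sum_norm_le)
    fix u assume u: "u \<in> U"
    have "complex_of_nat (n u) - of_real B = of_real (real (n u) - B)" by simp
    hence "norm (complex_of_nat (n u) - of_real B) = \<bar>real (n u) - B\<bar>" by (metis norm_of_real)
    thus "norm ((of_nat (n u) - of_real B) * \<Psi> u) \<le> B - real (n u)"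
      using nB[OF u] u \<Psi> by (simp add: norm_mult root_char_def U_def)
  qed
  also have "\<dots> = real d * B - real (card K')"
    using U sum_n by (simp add: sum_subtractf flip: of_nat_sum)
  also have "real d * B = real (R\<^sup>2 + (2 * w0 + 1) * R)" unfolding B_def using d(1) by simp
  also have "\<dots> - real (card K') \<le> real ((2 * w0 + 1) * R + 3)"
  proof -
    have "real (R\<^sup>2) \<le> real (card K' + 3)" using \<open>R\<^sup>2 \<le> card K' + 3\<close> by (simp only: of_nat_le_iff)
    thus ?thesis by simp
  qed
  finally show ?thesis unfolding K_def .
qed

text \<open>
  The map \<open>s \<mapsto> s^2 - 2\<close> pushes every value above 2 to infinity.
\<close>

lemma square_recursion_bounded_imp_le_2:
  fixes s :: "nat \<Rightarrow> real"
  assumes rec: "\<And>n. (s n)\<^sup>2 \<le> s (Suc n) + 2" and bounded: "\<And>n. n \<ge> n0 \<Longrightarrow> s n \<le> B"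
  shows "s 0 \<le> 2"
proof (rule ccontr)
  assume "\<not> s 0 \<le> 2"
  define \<delta> where "\<delta> = s 0 - 2"
  have \<delta>: "\<delta> > 0" using \<open>\<not> s 0 \<le> 2\<close> by (simp add: \<delta>_def)
  have grow: "s n \<ge> 2 + real n * \<delta>" for n
  proof (induction n)
    case (Suc n)
    show ?case
    proof (cases "n = 0")
      case True
      have "(2 + \<delta>)\<^sup>2 \<le> s 1 + 2" using rec[of 0] by (simp add: \<delta>_def)
      moreover have "(2 + \<delta>)\<^sup>2 = 4 + 4 * \<delta> + \<delta>\<^sup>2" by (simp add: power2_eq_square algebra_simps)
      ultimately have "2 + \<delta> \<le> s 1" using \<delta> zero_le_power2[of \<delta>] by linarith
      thus ?thesis using True by simp
    next
      case False
      define t where "t = real n * \<delta>"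
      have t: "t \<ge> \<delta>" using False \<delta> by (simp add: t_def)
      have "(2 + t)\<^sup>2 \<le> (s n)\<^sup>2" using Suc.IH t \<delta> by (intro power_mono) (auto simp: t_def)
      hence "(2 + t)\<^sup>2 \<le> s (Suc n) + 2" using rec[of n] by linarith
      moreover have "(2 + t)\<^sup>2 = 4 + 4 * t + t\<^sup>2" by (simp add: power2_eq_square algebra_simps)
      ultimately have "2 + t + \<delta> \<le> s (Suc n)" using t \<delta> zero_le_power2[of t] by linarith
      thus ?thesis by (simp add: t_def algebra_simps)
    qed
  next
    case 0
    show ?case using \<delta> by (simp add: \<delta>_def)
  qed
  obtain n1 where n1: "real n1 > B / \<delta>" using reals_Archimedean2 by blast
  define n where "n = max n0 n1"
  have "B / \<delta> < real n" using n1 by (simp add: n_def)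
  hence "B < real n * \<delta>" using \<delta> by (simp add: field_simps)
  thus False using grow[of n] bounded[of n] by (simp add: n_def)
qed

lemma fixfield_mono_power:
  assumes "x \<in> fixfield P"
  shows "x \<in> fixfield (P ^ n)"
proof (induction n)
  case (Suc n)
  thus ?case using assms by (simp add: fixfield_def power_mult)
qed (simp add: fixfield_def)

lemma dvd_square_minus_1:
  assumes "d dvd P - 1" "P > (0::nat)"
  shows "d dvd P\<^sup>2 - 1"
proof -
  have "P\<^sup>2 - 1 = (P - 1) * Suc P" using assms(2) by (cases P) (auto simp: power2_eq_square)
  thus ?thesis using assms(1) by simp
qed

lemma sum_lift_char_cube_trivial:
  fixes \<Psi> :: "'b::alg_closed_field \<Rightarrow> complex"
  assumes \<Psi>: "root_char d \<Psi>" and P: "P > 1" "d dvd P - 1"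
    and p: "prime CHAR('b)" "P = CHAR('b) ^ k"
    and triv: "\<And>t. t ^ d = 1 \<Longrightarrow> \<Psi> t ^ 3 = 1"
  shows "(\<Sum>x\<in>fixfield P. lift_char d \<Psi> P x ^ 3) = of_nat P - 1"
proof -
  note e = exponent_quotient[OF P]
  have "k > 0" using P(1) p(2) by (cases k) auto
  hence "of_nat P = (0::'b)" unfolding p(2) by simp
  hence fin: "finite (fixfield P :: 'b set)" "card (fixfield P :: 'b set) = P"
    using card_fixfield[OF P(1)] by blast+
  have 0: "(0::'b) \<in> fixfield P" using P(1) by (simp add: fixfield_def)
  have "(\<Sum>x\<in>fixfield P. lift_char d \<Psi> P x ^ 3) = (\<Sum>x\<in>fixfield P - {0}. lift_char d \<Psi> P x ^ 3)"
    using fin \<Psi> e(2) by (intro sum.mono_neutral_right) (auto simp: lift_char_def power_0_left root_char_def)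
  also have "\<dots> = (\<Sum>x\<in>fixfield P - {0::'b}. 1)"
  proof (rule sum.cong[OF refl])
    fix x :: 'b assume "x \<in> fixfield P - {0}"
    hence "x ^ (P - 1) = 1" using P(1) by (intro fixfield_power_eq_1) auto
    hence "(x ^ ((P - 1) div d)) ^ d = 1" using e(1) by (metis power_mult)
    thus "lift_char d \<Psi> P x ^ 3 = 1" using triv by (simp add: lift_char_def)
  qed
  also have "\<dots> = of_nat P - 1" using fin 0 P(1) by (simp add: card_Diff_singleton of_nat_diff)
  finally show ?thesis .
qed

text \<open>
  Normalised by the square root of the field size, the absolute values \<open>s n\<close> of the sums over
  the successive quadratic extensions satisfy \<open>(s n)^2 \<le> s (n+1) + 2\<close>. Stepanov's method bounds them
  for large \<open>n\<close> by a constant depending on \<open>d\<close> only, and a bounded sequence of this kind starts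
  at 2 or below.
\<close>

theorem weil_bound_cubic_sum:
  fixes \<Psi> :: "'b::alg_closed_field \<Rightarrow> complex"
  assumes \<Psi>: "root_char d \<Psi>" and p: "prime CHAR('b)" and R: "R = CHAR('b) ^ k" "k > 0"
    and d: "d \<ge> 3" "of_nat d \<noteq> (0::'b)" "d dvd R\<^sup>2 - 1"
    and w: "w ^ d = 1" "\<Psi> w ^ 2 \<noteq> 1"
    and c: "c \<in> fixfield (R\<^sup>2)" "c \<noteq> 0" "c \<noteq> 1"
  shows "norm (cubic_sum (fixfield (R\<^sup>2)) (lift_char d \<Psi> (R\<^sup>2)) c) \<le> 2 * real R"
proof -
  define Rn where "Rn = (\<lambda>n. R ^ (2 ^ n))"
  define S where "S = (\<lambda>n. norm (cubic_sum (fixfield ((Rn n)\<^sup>2)) (lift_char d \<Psi> ((Rn n)\<^sup>2)) c))"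
  define s where "s = (\<lambda>n. S n / real (Rn n))"
  have R1: "R > 1" unfolding R(1) by (rule one_less_power[OF prime_gt_1_nat[OF p] R(2)])
  have Rn_Suc: "Rn (Suc n) = (Rn n)\<^sup>2" for n
    by (simp add: Rn_def power_mult[symmetric] mult.commute)
  have Rn_pow: "Rn n = CHAR('b) ^ (k * 2 ^ n)" for n by (simp add: Rn_def R power_mult)
  have Rn1: "Rn n > 1" for n unfolding Rn_def by (rule one_less_power[OF R1]) simp
  have Rn_ge: "Rn n > n" for n
  proof -
    have "n < 2 ^ n" by simp
    also have "(2::nat) ^ n < 2 ^ (2 ^ n)" by (intro power_strict_increasing) auto
    also have "2 ^ (2 ^ n) \<le> R ^ (2 ^ n)" using R1 by (intro power_mono) auto
    finally show ?thesis by (simp add: Rn_def)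
  qed
  have dvd: "d dvd (Rn n)\<^sup>2 - 1" for n
  proof (induction n)
    case (Suc n)
    thus ?case using dvd_square_minus_1[OF Suc] Rn1[of n] by (simp add: Rn_Suc)
  next
    case 0
    show ?case using d(3) by (simp only: Rn_def power_0 power_one_right)
  qed
  have c': "c \<in> fixfield ((Rn n)\<^sup>2)" for n
    using fixfield_mono_power[OF c(1), of "2 ^ n"] by (simp add: Rn_def mult.commute flip: power_mult)
  have "(s n)\<^sup>2 \<le> s (Suc n) + 2" for n
  proof -
    define P where "P = (Rn n)\<^sup>2"
    have P1: "P > 1" unfolding P_def using Rn1[of n] by (rule one_less_power) simp
    have P: "P = CHAR('b) ^ (2 * (k * 2 ^ n))" unfolding P_def Rn_pow by (simp add: mult.commute flip: power_mult)
    have dP: "d dvd P - 1" unfolding P_def by (rule dvd)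
    have cP: "c \<in> fixfield P" unfolding P_def by (rule c')
    obtain a where a: "S n ^ 2 \<le> S (Suc n) + 2 * a" "a \<ge> 0"
       "complex_of_real (a\<^sup>2) = of_nat P * (of_nat P - (\<Sum>x\<in>fixfield P. lift_char d \<Psi> P x ^ 3))"
      using norm_cubic_sum_square_le_quadratic_extension[OF \<Psi> P1 dP p P w cP c(2,3)]
      by (auto simp: S_def Rn_Suc P_def)
    have "a\<^sup>2 \<le> (real P)\<^sup>2"
    proof (cases "\<exists>t. t ^ d = 1 \<and> \<Psi> t ^ 3 \<noteq> 1")
      case True
      then obtain t where "t ^ d = 1" "\<Psi> t ^ 3 \<noteq> 1" by auto
      hence "(\<Sum>x\<in>fixfield P. lift_char d \<Psi> P x ^ 3) = 0"
        using sum_lift_char_power_eq_0[OF \<Psi> P1 dP p P] by simp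
      hence "complex_of_real (a\<^sup>2) = complex_of_real ((real P)\<^sup>2)" using a(3) by (simp add: power2_eq_square)
      thus ?thesis by (simp only: of_real_eq_iff)
    next
      case False
      hence "(\<Sum>x\<in>fixfield P. lift_char d \<Psi> P x ^ 3) = of_nat P - 1"
        using sum_lift_char_cube_trivial[OF \<Psi> P1 dP p P] by blast
      hence "complex_of_real (a\<^sup>2) = complex_of_real (real P)" using a(3) by simp
      hence "a\<^sup>2 = real P" by (simp only: of_real_eq_iff)
      also have "\<dots> \<le> (real P)\<^sup>2" using P1 by (simp add: power2_eq_square)
      finally show ?thesis .
    qed
    hence aP: "a \<le> real P" using a(2) by (simp add: abs_le_square_iff[symmetric])
    have "(s n)\<^sup>2 = (S n)\<^sup>2 / real P" by (simp add: s_def P_def power_divide)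
    also have "\<dots> \<le> (S (Suc n) + 2 * real P) / real P"
      using a(1) aP P1 by (intro divide_right_mono) auto
    also have "\<dots> = s (Suc n) + 2" using P1 Rn1[of n] by (simp add: s_def Rn_Suc P_def add_divide_distrib)
    finally show ?thesis .
  qed
  moreover define w0 where "w0 = (d - 1)\<^sup>2"
  have "s n \<le> real (2 * w0 + 4)" if n: "n \<ge> w0\<^sup>2 + 3 * w0 + d" for n
  proof -
    have "Rn n > w0\<^sup>2 + 3 * w0 + d" using n Rn_ge[of n] by linarith
    hence "S n \<le> real ((2 * w0 + 1) * Rn n + 3)"
      unfolding S_def
      by (rule norm_cubic_sum_bounded[OF \<Psi> p Rn_pow d(1,2) dvd _ w0_def w(1) _ c' c(2)]) (use w in auto)
    also have "(2 * w0 + 1) * Rn n + 3 \<le> (2 * w0 + 4) * Rn n"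
      using Rn1[of n] by (simp add: algebra_simps)
    finally show ?thesis using Rn1[of n] by (simp add: s_def field_simps)
  qed
  ultimately have "s 0 \<le> 2" by (rule square_recursion_bounded_imp_le_2)
  thus ?thesis using R1 by (simp add: s_def S_def Rn_def field_simps)
qed

section \<open>Finite subfields\<close>

lemma finite_subfield_power_card:
  assumes K: "is_subfield K" "finite K" and x: "x \<in> (K :: 'a::field set)"
  shows "x ^ card K = x"
proof (cases "x = 0")
  case True
  have "card K > 0" using K(2) x by (auto simp: card_gt_0_iff)
  thus ?thesis using True by (simp add: power_0_left)
next
  case False
  note KD = is_subfieldD[OF K(1)]
  have "(\<Prod>y\<in>K-{0}. y) = (\<Prod>y\<in>K-{0}. x * y)"
    by (rule prod.reindex_bij_witness[of _ "\<lambda>y. x * y" "\<lambda>y. y / x"]) (use KD x False in auto)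
  also have "\<dots> = x ^ card (K - {0}) * (\<Prod>y\<in>K-{0}. y)" by (simp add: prod.distrib)
  finally have "x ^ card (K - {0}) = 1" using K(2) by simp
  moreover have "card K = Suc (card (K - {0}))" using K(2) KD(1) by (rule card.remove)
  ultimately show ?thesis by simp
qed

lemma finite_subfield_eq_fixfield:
  assumes K: "is_subfield K" "finite (K :: 'a::field set)"
  shows "K = fixfield (card K)"
proof -
  define p :: "'a poly" where "p = monom 1 (card K) - [:0, 1:]"
  have "card {0, 1::'a} \<le> card K" using K is_subfieldD(1,2)[OF K(1)] by (intro card_mono) auto
  hence K1: "card K > 1" by simp
  have px: "poly p x = x ^ card K - x" for x by (simp add: p_def poly_monom)
  have deg: "degree p = card K"
    unfolding p_def diff_conv_add_uminus using K1
    by (subst degree_add_eq_left) (auto simp: degree_monom_eq)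
  have "p \<noteq> 0" using deg K1 by auto
  have eq: "fixfield (card K) = {x. poly p x = 0}" by (simp add: px fixfield_def)
  show ?thesis
  proof (rule card_seteq)
    show "finite (fixfield (card K) :: 'a set)" unfolding eq by (rule poly_roots_finite) fact
    show "K \<subseteq> fixfield (card K)" using finite_subfield_power_card[OF K] by (auto simp: fixfield_def)
    show "card (fixfield (card K) :: 'a set) \<le> card K"
      unfolding eq using card_poly_roots_bound[OF \<open>p \<noteq> 0\<close>] deg by simp
  qed
qed

text \<open>
  By Sylow's theorem a prime divisor \<open>l\<close> of the order yields a nonzero element of additive order
  \<open>l\<close>.
\<close>

lemma card_finite_subfield:
  assumes K: "is_subfield K" "finite (K :: 'a::field set)" and p: "prime CHAR('a)"
  shows "\<exists>k>0. card K = CHAR('a) ^ k"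
proof -
  note KD = is_subfieldD[OF K(1)]
  have only: "l = CHAR('a)" if l: "prime l" "l dvd card K" for l
  proof -
    define G :: "'a monoid" where "G = \<lparr>carrier = K, monoid.mult = (+), one = 0\<rparr>"
    have G: "group G"
      by (rule groupI) (auto simp: G_def KD add_ac intro!: bexI[of _ "- _"])
    obtain m where m: "card K = l ^ 1 * m" using l(2) by auto
    obtain H where H: "subgroup H G" "card H = l ^ 1"
      using sylow_thm[OF l(1) G, of 1 m] m K(2) by (auto simp: G_def Coset.order_def)
    interpret G: group G by (rule G)
    interpret H: group "G\<lparr>carrier := H\<rparr>" using G.subgroup_imp_group[OF H(1)] .
    have "H \<noteq> {0}" using H(2) prime_gt_1_nat[OF l(1)] by auto
    moreover have "0 \<in> H" using subgroup.one_closed[OF H(1)] by (simp add: G_def)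
    ultimately obtain x where x: "x \<in> H" "x \<noteq> 0" by auto
    have pow: "x [^]\<^bsub>G\<lparr>carrier := H\<rparr>\<^esub> n = of_nat n * x" for n :: nat
      by (induction n) (simp_all add: G_def algebra_simps)
    have "x [^]\<^bsub>G\<lparr>carrier := H\<rparr>\<^esub> Coset.order (G\<lparr>carrier := H\<rparr>) = \<one>\<^bsub>G\<lparr>carrier := H\<rparr>\<^esub>"
      by (rule H.pow_order_eq_1) (simp add: x)
    hence "of_nat l * x = 0" using H(2) unfolding pow by (simp add: Coset.order_def G_def)
    hence "CHAR('a) dvd l" using x(2) by (simp add: of_nat_eq_0_iff_char_dvd)
    thus ?thesis using primes_dvd_imp_eq[OF p l(1)] by simp
  qed
  have "card {0, 1::'a} \<le> card K" using K KD(1,2) by (intro card_mono) auto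
  hence K1: "card K > 1" by simp
  hence "card K \<noteq> 0" by simp
  then obtain k m where m: "card K = CHAR('a) ^ k * m" "\<not> CHAR('a) dvd m"
    using multiplicity_decompose'[of "card K" "CHAR('a)"] p
    by (metis not_prime_unit)
  have "m = 1"
  proof (rule ccontr)
    assume "m \<noteq> 1"
    then obtain l where "prime l" "l dvd m" using prime_factor_nat by blast
    thus False using only[of l] m by auto
  qed
  hence "card K = CHAR('a) ^ k" using m by simp
  moreover have "k > 0" using calculation K1 by (cases k) auto
  ultimately show ?thesis by blast
qed

section \<open>Characters trivial on the base field of a quadratic extension\<close>

context
  fixes K :: "'a::{field, finite} set" and q :: nat
  assumes K: "is_subfield K" and card_K: "card K = q" and card_UNIV: "CARD('a) = q\<^sup>2"
begin

lemma q_gt_1: "q > 1"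
proof -
  have "card {0, 1::'a} \<le> card K" using is_subfieldD(1,2)[OF K] by (intro card_mono) auto
  thus ?thesis using card_K by simp
qed

lemma sum_split_subfield: "(\<Sum>x\<in>UNIV. f x) = (\<Sum>x\<in>K. f x) + (\<Sum>x\<in>-K. f x)"
  for f :: "'a \<Rightarrow> complex"
  by (subst sum.union_disjoint[symmetric]) (auto intro: sum.cong)

lemma sum_subfield_trivial:
  assumes "\<chi> 0 = 0" "\<And>x. x \<in> K \<Longrightarrow> x \<noteq> 0 \<Longrightarrow> \<chi> x = (1::complex)"
  shows "(\<Sum>x\<in>K. \<chi> x) = of_nat q - 1"
proof -
  have "(\<Sum>x\<in>K. \<chi> x) = (\<Sum>x\<in>K-{0}. \<chi> x)"
    using assms(1) by (intro sum.mono_neutral_right) auto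
  also have "\<dots> = (\<Sum>x\<in>K-{0}. 1)" using assms(2) by (intro sum.cong) auto
  also have "\<dots> = of_nat q - 1"
    using card_K q_gt_1 is_subfieldD(1)[OF K] by (simp add: card_Diff_singleton of_nat_diff)
  finally show ?thesis .
qed

text \<open>
  The nonzero multiples of the elements of \<open>x + K\<close> by scalars from \<open>K\<close> exhaust the complement of
  \<open>K\<close>, and \<open>\<chi>\<close> does not see the scalars.
\<close>

lemma sum_affine_line:
  assumes \<chi>: "char_on UNIV \<chi>" and triv: "\<And>x. x \<in> K \<Longrightarrow> x \<noteq> 0 \<Longrightarrow> \<chi> x = 1"
    and sum0: "(\<Sum>x\<in>UNIV. \<chi> x) = 0" and x: "x \<notin> K"
  shows "(\<Sum>c\<in>K. \<chi> (x + c)) = -1"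
proof -
  note KD = is_subfieldD[OF K]
  note \<chi>' = char_on_simps[OF \<chi>]
  define F where "F = (\<lambda>(t, c). t * (x + c))"
  have inj: "inj_on F ((K - {0}) \<times> K)"
  proof (rule inj_onI)
    fix a b assume ab: "a \<in> (K - {0}) \<times> K" "b \<in> (K - {0}) \<times> K" "F a = F b"
    obtain t c t' c' where eqs: "a = (t, c)" "b = (t', c')" by (metis surj_pair)
    have *: "t \<in> K" "c \<in> K" "t' \<in> K" "c' \<in> K" "t \<noteq> 0" "F (t, c) = F (t', c')"
      using ab by (auto simp: eqs)
    hence eq: "(t - t') * x = t' * c' - t * c" by (simp add: F_def algebra_simps)
    have "t = t'"
    proof (rule ccontr)
      assume "t \<noteq> t'"
      hence "x = (t' * c' - t * c) / (t - t')" using eq by (simp add: field_simps)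
      also have "\<dots> \<in> K" using * by (auto intro!: KD(3,6,8))
      finally show False using x by simp
    qed
    thus "a = b" using * by (simp add: F_def eqs)
  qed
  have sub: "F ` ((K - {0}) \<times> K) \<subseteq> -K"
  proof (rule subsetI, rule ComplI)
    fix y assume "y \<in> F ` ((K - {0}) \<times> K)" "y \<in> K"
    then obtain t c where *: "t \<in> K" "t \<noteq> 0" "c \<in> K" "F (t, c) \<in> K" by auto
    have "x = F (t, c) / t - c" using * by (simp add: F_def)
    also have "\<dots> \<in> K" using * by (auto intro!: KD(3,6,8))
    finally show False using x by simp
  qed
  have "card (F ` ((K - {0}) \<times> K)) = card (-K)"
    unfolding card_image[OF inj] using card_K card_UNIV KD(1)
    by (simp add: card_cartesian_product Compl_eq_Diff_UNIV card_Diff_subset card_Diff_singleton power2_eq_square diff_mult_distrib)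
  hence img: "F ` ((K - {0}) \<times> K) = -K" using sub by (intro card_subset_eq) auto
  have "(\<Sum>y\<in>-K. \<chi> y) = (\<Sum>tc\<in>(K - {0}) \<times> K. \<chi> (F tc))"
    unfolding img[symmetric] by (subst sum.reindex[OF inj]) simp
  also have "\<dots> = (\<Sum>tc\<in>(K - {0}) \<times> K. \<chi> (x + snd tc))"
  proof (rule sum.cong[OF refl])
    fix tc assume "tc \<in> (K - {0}) \<times> K"
    hence "fst tc \<in> K" "fst tc \<noteq> 0" by auto
    hence "\<chi> (fst tc) = 1" by (rule triv)
    thus "\<chi> (F tc) = \<chi> (x + snd tc)" by (simp add: F_def \<chi>' case_prod_unfold)
  qed
  also have "\<dots> = (\<Sum>t\<in>K-{0}. \<Sum>c\<in>K. \<chi> (x + c))"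
    by (simp only: sum.cartesian_product case_prod_unfold)
  also have "\<dots> = (of_nat q - 1) * (\<Sum>c\<in>K. \<chi> (x + c))"
    using card_K q_gt_1 KD(1) by (simp add: card_Diff_singleton of_nat_diff)
  finally have "(of_nat q - 1) * (1 + (\<Sum>c\<in>K. \<chi> (x + c))) = 0"
    using sum0 sum_split_subfield[of \<chi>] sum_subfield_trivial[of \<chi>] \<chi>'(1) triv
    by (simp add: distrib_left)
  moreover have "of_nat q - 1 \<noteq> (0::complex)" using q_gt_1 by simp
  ultimately have "1 + (\<Sum>c\<in>K. \<chi> (x + c)) = 0" by simp
  thus ?thesis by (simp add: add_eq_0_iff)
qed

text \<open>
  Averaging over \<open>x \<mapsto> t * x\<close> with \<open>t\<close> in \<open>K - {0}\<close> replaces \<open>\<psi> (x + 1)\<close> by a sum over an affine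
  line.
\<close>

lemma sum_off_subfield_two_chars:
  assumes \<chi>: "char_on UNIV \<chi>" "\<And>x. x \<in> K \<Longrightarrow> x \<noteq> 0 \<Longrightarrow> \<chi> x = 1" "(\<Sum>x\<in>UNIV. \<chi> x) = 0"
    and \<psi>: "char_on UNIV \<psi>" "\<And>x. x \<in> K \<Longrightarrow> x \<noteq> 0 \<Longrightarrow> \<psi> x = 1" "(\<Sum>x\<in>UNIV. \<psi> x) = 0"
  shows "(of_nat q - 1) * (\<Sum>x\<in>-K. \<chi> x * \<psi> (x + 1)) =
           2 * (of_nat q - 1) - (\<Sum>x\<in>UNIV. \<chi> x * \<psi> x)"
proof -
  note KD = is_subfieldD[OF K]
  note \<chi>' = char_on_simps[OF \<chi>(1)] and \<psi>' = char_on_simps[OF \<psi>(1)]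
  have scale: "(\<Sum>x\<in>-K. \<chi> x * \<psi> (x + 1)) = (\<Sum>x\<in>-K. \<chi> x * \<psi> (x + t))"
    if t: "t \<in> K - {0}" for t
  proof (rule sum.reindex_bij_witness[of _ "\<lambda>x. x / t" "\<lambda>x. x * t"])
    fix x assume "x \<in> - K"
    show "\<chi> (x * t) * \<psi> (x * t + t) = \<chi> x * \<psi> (x + 1)"
    proof -
      have "x * t + t = (x + 1) * t" by (simp add: algebra_simps)
      thus ?thesis using t by (simp only: \<chi>' \<psi>' UNIV_I) (simp add: \<chi> \<psi>)
    qed
    show "x / t \<in> - K" using \<open>x \<in> - K\<close> t KD(6)[of "x / t" t] by auto
    show "x * t \<in> - K" using \<open>x \<in> - K\<close> t KD(8)[of "x * t" t] by auto
  qed (use t in auto)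
  have off: "(\<Sum>x\<in>-K. \<theta> x) = (\<Sum>x\<in>UNIV. \<theta> x) - (of_nat q - 1)"
    if "\<theta> 0 = 0" "\<And>x. x \<in> K \<Longrightarrow> x \<noteq> 0 \<Longrightarrow> \<theta> x = 1" for \<theta> :: "'a \<Rightarrow> complex"
    using sum_split_subfield[of \<theta>] sum_subfield_trivial[of \<theta>] that by simp
  have "(of_nat q - 1) * (\<Sum>x\<in>-K. \<chi> x * \<psi> (x + 1)) = (\<Sum>t\<in>K-{0}. \<Sum>x\<in>-K. \<chi> x * \<psi> (x + 1))"
    using card_K q_gt_1 KD(1) by (simp add: card_Diff_singleton of_nat_diff)
  also have "\<dots> = (\<Sum>t\<in>K-{0}. \<Sum>x\<in>-K. \<chi> x * \<psi> (x + t))"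
    by (rule sum.cong[OF refl]) (rule scale)
  also have "\<dots> = (\<Sum>x\<in>-K. \<chi> x * (\<Sum>t\<in>K-{0}. \<psi> (x + t)))"
    by (subst sum.swap) (simp add: sum_distrib_left)
  also have "\<dots> = (\<Sum>x\<in>-K. \<chi> x * (-1 - \<psi> x))"
  proof (rule sum.cong[OF refl])
    fix x assume "x \<in> - K"
    hence "(\<Sum>t\<in>K. \<psi> (x + t)) = -1" using sum_affine_line[OF \<psi>(1-3)] by blast
    moreover have "(\<Sum>t\<in>K. \<psi> (x + t)) = \<psi> (x + 0) + (\<Sum>t\<in>K-{0}. \<psi> (x + t))"
      by (rule sum.remove) (auto simp: KD)
    ultimately have "(\<Sum>t\<in>K-{0}. \<psi> (x + t)) = -1 - \<psi> x" by (simp add: eq_diff_eq add.commute)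
    thus "\<chi> x * (\<Sum>t\<in>K-{0}. \<psi> (x + t)) = \<chi> x * (-1 - \<psi> x)" by simp
  qed
  also have "\<dots> = - (\<Sum>x\<in>-K. \<chi> x) - (\<Sum>x\<in>-K. \<chi> x * \<psi> x)"
    by (simp add: right_diff_distrib sum_subtractf sum_negf)
  also have "\<dots> = 2 * (of_nat q - 1) - (\<Sum>x\<in>UNIV. \<chi> x * \<psi> x)"
    using off[of \<chi>] off[of "\<lambda>x. \<chi> x * \<psi> x"] \<chi> \<psi> \<chi>' by simp
  finally show ?thesis .
qed

lemma sum_on_subfield_two_chars:
  assumes "\<chi> 0 = 0" "\<And>x. x \<in> K \<Longrightarrow> x \<noteq> 0 \<Longrightarrow> \<chi> x = 1"
    and "\<psi> 0 = 0" "\<And>x. x \<in> K \<Longrightarrow> x \<noteq> 0 \<Longrightarrow> \<psi> x = (1::complex)"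
  shows "(\<Sum>x\<in>K. \<chi> x * \<psi> (x + 1)) = of_nat q - 2"
proof -
  note KD = is_subfieldD[OF K]
  have "(\<Sum>x\<in>K. \<chi> x * \<psi> (x + 1)) = (\<Sum>x\<in>K-{0,-1}. \<chi> x * \<psi> (x + 1))"
    using assms by (intro sum.mono_neutral_right) auto
  also have "\<dots> = (\<Sum>x\<in>K-{0,-1}. 1)"
    using assms KD by (intro sum.cong refl) (auto simp: add_eq_0_iff2)
  also have "\<dots> = of_nat q - 2"
  proof -
    have "card (K - {0, -1}) = q - 2"
      using KD card_K by (subst card_Diff_subset) auto
    thus ?thesis using q_gt_1 by (simp add: of_nat_diff)
  qed
  finally show ?thesis .
qed

lemma sum_two_chars:
  assumes \<chi>: "char_on UNIV \<chi>" "\<And>x. x \<in> K \<Longrightarrow> x \<noteq> 0 \<Longrightarrow> \<chi> x = 1" "(\<Sum>x\<in>UNIV. \<chi> x) = 0"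
    and \<psi>: "char_on UNIV \<psi>" "\<And>x. x \<in> K \<Longrightarrow> x \<noteq> 0 \<Longrightarrow> \<psi> x = 1" "(\<Sum>x\<in>UNIV. \<psi> x) = 0"
  shows "(of_nat q - 1) * (\<Sum>x\<in>UNIV. \<chi> x * \<psi> (x + 1)) =
           (of_nat q - 1) * of_nat q - (\<Sum>x\<in>UNIV. \<chi> x * \<psi> x)"
proof -
  have "(\<Sum>x\<in>UNIV. \<chi> x * \<psi> (x + 1)) = of_nat q - 2 + (\<Sum>x\<in>-K. \<chi> x * \<psi> (x + 1))"
    unfolding sum_split_subfield[of "\<lambda>x. \<chi> x * \<psi> (x + 1)"]
    using sum_on_subfield_two_chars[of \<chi> \<psi>] \<chi> \<psi> by (simp add: char_on_def)
  moreover have "(of_nat q - 1) * (\<Sum>x\<in>-K. \<chi> x * \<psi> (x + 1)) =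
           2 * (of_nat q - 1) - (\<Sum>x\<in>UNIV. \<chi> x * \<psi> x)"
    using sum_off_subfield_two_chars[of \<chi> \<psi>] \<chi> \<psi> by blast
  ultimately have "(of_nat q - 1) * (\<Sum>x\<in>UNIV. \<chi> x * \<psi> (x + 1)) =
      (of_nat q - 1) * (of_nat q - 2) + (2 * (of_nat q - 1) - (\<Sum>x\<in>UNIV. \<chi> x * \<psi> x))"
    by (simp only: distrib_left)
  thus ?thesis by (simp add: algebra_simps)
qed

text \<open>
  Summing over \<open>c\<close> first leaves sums over affine lines parallel to \<open>K\<close>, which are \<open>-1\<close> off \<open>K\<close> and
  \<open>q - 1\<close> on \<open>K\<close>.
\<close>

lemma sum_cubic_sums:
  assumes \<chi>: "char_on UNIV \<chi>" "\<And>x. x \<in> K \<Longrightarrow> x \<noteq> 0 \<Longrightarrow> \<chi> x = 1" "(\<Sum>x\<in>UNIV. \<chi> x) = 0"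
    and sq: "(\<Sum>x\<in>UNIV. \<chi> x * \<chi> x) = 0"
  shows "(\<Sum>c\<in>K. cubic_sum UNIV \<chi> c) = (of_nat q)\<^sup>2 - 3 * of_nat q"
proof -
  note KD = is_subfieldD[OF K]
  note \<chi>' = char_on_simps[OF \<chi>(1)]
  have "(\<Sum>c\<in>K. cubic_sum UNIV \<chi> c) = (\<Sum>x\<in>UNIV. \<chi> x * \<chi> (x + 1) * (\<Sum>c\<in>K. \<chi> (x + c)))"
    unfolding cubic_sum_def by (subst sum.swap) (simp add: \<chi>' sum_distrib_left)
  also have "\<dots> = (\<Sum>x\<in>K. \<chi> x * \<chi> (x + 1) * (of_nat q - 1)) + (\<Sum>x\<in>-K. \<chi> x * \<chi> (x + 1) * (-1))"
    unfolding sum_split_subfield[of "\<lambda>x. \<chi> x * \<chi> (x + 1) * (\<Sum>c\<in>K. \<chi> (x + c))"]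
  proof (intro arg_cong2[where f = "(+)"] sum.cong refl)
    fix x assume x: "x \<in> K"
    have "(\<Sum>c\<in>K. \<chi> (x + c)) = (\<Sum>c\<in>K. \<chi> c)"
      by (rule sum.reindex_bij_witness[of _ "\<lambda>c. c - x" "\<lambda>c. x + c"]) (use x KD in auto)
    thus "\<chi> x * \<chi> (x + 1) * (\<Sum>c\<in>K. \<chi> (x + c)) = \<chi> x * \<chi> (x + 1) * (of_nat q - 1)"
      using sum_subfield_trivial[of \<chi>] \<chi>'(1) \<chi>(2) by simp
  next
    fix x assume "x \<in> - K"
    thus "\<chi> x * \<chi> (x + 1) * (\<Sum>c\<in>K. \<chi> (x + c)) = \<chi> x * \<chi> (x + 1) * (-1)"
      using sum_affine_line[OF \<chi>] by simp
  qed
  also have "\<dots> = (of_nat q - 2) * (of_nat q - 1) - (\<Sum>x\<in>-K. \<chi> x * \<chi> (x + 1))"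
    using sum_on_subfield_two_chars[of \<chi> \<chi>] \<chi>'(1) \<chi>(2) by (simp add: sum_negf flip: sum_distrib_right)
  also have "(\<Sum>x\<in>-K. \<chi> x * \<chi> (x + 1)) = 2"
  proof -
    have "of_nat q - 1 \<noteq> (0::complex)" using q_gt_1 by simp
    moreover have "(of_nat q - 1) * (\<Sum>x\<in>-K. \<chi> x * \<chi> (x + 1)) = (of_nat q - 1) * 2"
    proof -
      have "(of_nat q - 1) * (\<Sum>x\<in>-K. \<chi> x * \<chi> (x + 1)) =
          2 * (of_nat q - 1) - (\<Sum>x\<in>UNIV. \<chi> x * \<chi> x)"
        using sum_off_subfield_two_chars[of \<chi> \<chi>] \<chi> by blast
      thus ?thesis unfolding sq by (simp only: diff_0_right mult.commute)
    qed
    ultimately show ?thesis by (metis mult_left_cancel)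
  qed
  finally show ?thesis by (simp add: power2_eq_square algebra_simps)
qed

text \<open>
  For these \<open>c\<close> two of the three linear factors coincide, so that \<open>\<chi>^2\<close> and \<open>\<chi>\<close> take the
  parts of the two characters.
\<close>

lemma cubic_sum_degenerate:
  assumes \<chi>: "char_on UNIV \<chi>" "\<And>x. x \<in> K \<Longrightarrow> x \<noteq> 0 \<Longrightarrow> \<chi> x = 1" "(\<Sum>x\<in>UNIV. \<chi> x) = 0"
    and sq: "(\<Sum>x\<in>UNIV. \<chi> x * \<chi> x) = 0" and c: "c \<in> {0, 1}"
  shows "(of_nat q - 1) * cubic_sum UNIV \<chi> c = (of_nat q - 1) * of_nat q - (\<Sum>x\<in>UNIV. \<chi> x ^ 3)"
proof -
  note \<chi>' = char_on_simps[OF \<chi>(1)]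
  have \<chi>2: "char_on UNIV (\<lambda>x. \<chi> x * \<chi> x)" by (rule char_on_mult) fact+
  have \<chi>2K: "\<chi> x * \<chi> x = 1" if "x \<in> K" "x \<noteq> 0" for x using \<chi>(2)[OF that] by simp
  show ?thesis
  proof (cases "c = 0")
    case True
    thus ?thesis using sum_two_chars[OF \<chi>2 \<chi>2K sq \<chi>]
      by (simp add: cubic_sum_def \<chi>' power3_eq_cube mult_ac)
  next
    case False
    thus ?thesis using sum_two_chars[OF \<chi> \<chi>2 \<chi>2K sq] c
      by (simp add: cubic_sum_def \<chi>' power3_eq_cube mult_ac)
  qed
qed

end

section \<open>The number of parameters with an extremal cubic sum\<close>

text \<open>
  Identifies the given finite field inside its algebraic closure, where the tower of quadratic
  extensions lives.
\<close>

lemma range_to_ac_eq_fixfield: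
  "range (to_ac :: 'a::{field, finite} \<Rightarrow> _) = fixfield CARD('a)"
proof -
  have "is_subfield (range (to_ac :: 'a \<Rightarrow> _))"
    unfolding is_subfield_def
    by (auto simp flip: to_ac_diff to_ac_mult to_ac_inverse intro: range_eqI[of _ _ 0] range_eqI[of _ _ 1])
  from finite_subfield_eq_fixfield[OF this] show ?thesis
    by (simp add: card_image inj_to_ac)
qed

lemma char_order_dvd_imp:
  assumes "mult_char \<chi>" "char_order \<chi> dvd d" "x \<noteq> 0"
  shows "\<chi> x ^ d = 1"
    and "char_order \<chi> > 2 \<Longrightarrow> \<exists>y. y \<noteq> 0 \<and> \<chi> y ^ 2 \<noteq> 1"
proof -
  let ?G = "char_group :: ('a \<Rightarrow> complex) monoid"
  interpret G: comm_group ?G by (rule comm_group_char_group)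
  have \<chi>: "\<chi> \<in> carrier ?G" using assms(1) by (simp add: char_group_def)
  have pow: "\<chi> [^]\<^bsub>?G\<^esub> n = (\<lambda>x. if x = 0 then 0 else \<chi> x ^ n)" for n :: nat
  proof (induction n)
    case (Suc n)
    thus ?case using assms(1) by (auto simp: char_group_def fun_eq_iff mult_char_def)
  qed (auto simp: char_group_def fun_eq_iff)
  have iff: "char_order \<chi> dvd n \<longleftrightarrow> (\<forall>y. y \<noteq> 0 \<longrightarrow> \<chi> y ^ n = 1)" for n
    unfolding char_order_def G.pow_eq_id[OF \<chi>, symmetric] pow
    by (auto simp: char_group_def fun_eq_iff)
  show "\<chi> x ^ d = 1" using iff assms by blast
  show "\<exists>y. y \<noteq> 0 \<and> \<chi> y ^ 2 \<noteq> 1" if "char_order \<chi> > 2"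
    using iff[of 2] that dvd_imp_le[of "char_order \<chi>" 2] by fastforce
qed

context
  fixes K :: "'a::{field, finite} set" and q :: nat and \<chi> :: "'a \<Rightarrow> complex"
  assumes K: "is_subfield K" and card_K: "card K = q" and card_UNIV: "CARD('a) = q\<^sup>2"
    and \<chi>: "char_on UNIV \<chi>" and order: "\<And>x. x \<noteq> 0 \<Longrightarrow> \<chi> x ^ (q + 1) = 1"
begin

lemmas q1 = q_gt_1[OF K card_K card_UNIV]

lemma square_minus_1: "q\<^sup>2 - 1 = (q + 1) * (q - 1)"
  using q1 by (cases q) (auto simp: power2_eq_square)

lemma quotient_exponent: "(q\<^sup>2 - 1) div (q + 1) = q - 1"
  by (simp only: square_minus_1) (simp del: mult_Suc)

lemma mem_range_to_ac:
  assumes "y ^ (q\<^sup>2 - 1) = 1"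
  shows "y \<in> range (to_ac :: 'a \<Rightarrow> _)"
proof -
  have "q\<^sup>2 > 0" using q1 by simp
  hence "y ^ q\<^sup>2 = y * y ^ (q\<^sup>2 - 1)" by (simp flip: power_Suc)
  thus ?thesis unfolding range_to_ac_eq_fixfield using assms by (simp add: fixfield_def card_UNIV)
qed

text \<open>
  The elements of \<open>K - {0}\<close> are norms, that is \<open>(q + 1)\<close>-th powers.
\<close>

lemma char_trivial_on_subfield:
  assumes x: "x \<in> K" "x \<noteq> 0"
  shows "\<chi> x = 1"
proof -
  obtain y where y: "y ^ (q + 1) = to_ac x" using nth_root_exists[of "q + 1"] by auto
  have "x ^ (q - 1) = 1"
    using fixfield_power_eq_1[of x q] finite_subfield_eq_fixfield[OF K] x card_K q1 by auto
  hence "y ^ (q\<^sup>2 - 1) = 1"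
    unfolding square_minus_1 power_mult y to_ac_power[symmetric] by simp
  then obtain z where z: "y = to_ac z" using mem_range_to_ac by auto
  have "x = z ^ (q + 1)" using y unfolding z to_ac_power[symmetric] by (simp only: to_ac_eq_iff)
  moreover have "z \<noteq> 0" using calculation x by auto
  moreover have "\<chi> (z ^ n) = \<chi> z ^ n" for n
    by (induction n) (simp_all add: char_on_simps[OF \<chi>] char_on_1[OF \<chi>] is_subfield_def)
  ultimately show ?thesis using order[of z] by metis
qed

text \<open>
  Since \<open>\<chi>\<close> is trivial on \<open>K - {0}\<close>, the kernel of \<open>y \<mapsto> y^(q-1)\<close>, it factors through this map onto the
  \<open>(q + 1)\<close>-th roots of unity.
\<close>

lemma root_char_of_char:
  obtains \<Psi> where "root_char (q + 1) \<Psi>" "\<And>y. lift_char (q + 1) \<Psi> (q\<^sup>2) (to_ac y) = \<chi> y"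
proof -
  define \<Psi> where "\<Psi> = (\<lambda>z. if z = 0 then 0 else \<chi> (SOME y. to_ac (y ^ (q - 1)) = z))"
  note \<chi>' = char_on_simps[OF \<chi>]
  have sub: "is_subfield (UNIV :: 'a set)" by (simp add: is_subfield_def)
  have val: "\<Psi> (to_ac (y ^ (q - 1))) = \<chi> y" if y: "y \<noteq> 0" for y
  proof -
    define y' where "y' = (SOME y'. to_ac (y' ^ (q - 1)) = to_ac (y ^ (q - 1)))"
    have "to_ac (y' ^ (q - 1)) = to_ac (y ^ (q - 1))"
      unfolding y'_def by (rule someI[of _ y]) simp
    hence eq: "y' ^ (q - 1) = y ^ (q - 1)" by (simp del: to_ac_power)
    have y': "y' \<noteq> 0" using eq y q1 by (auto simp: power_0_left)
    have "(y' / y) ^ (q - 1) = 1" using eq y by (simp add: power_divide)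
    moreover have "(y' / y) ^ q = (y' / y) * (y' / y) ^ (q - 1)"
      using q1 by (simp flip: power_Suc)
    ultimately have "y' / y \<in> K"
      using finite_subfield_eq_fixfield[OF K] card_K by (simp add: fixfield_def)
    hence "\<chi> (y' / y) = 1" using y y' by (intro char_trivial_on_subfield) auto
    moreover have "\<chi> y' = \<chi> (y' / y) * \<chi> y" using y by (simp flip: \<chi>'(2))
    ultimately have "\<chi> y' = \<chi> y" by simp
    thus ?thesis using y unfolding \<Psi>_def y'_def[symmetric] by simp
  qed
  have ex: "\<exists>y. y \<noteq> 0 \<and> z = to_ac (y ^ (q - 1))" if z: "z ^ (q + 1) = 1" for z :: "'a alg_closure"
  proof -
    obtain y where y: "y ^ (q - 1) = z" using nth_root_exists[of "q - 1"] q1 by auto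
    have "y ^ (q\<^sup>2 - 1) = 1"
      using z unfolding square_minus_1 mult.commute[of "q + 1"] power_mult y .
    then obtain t where t: "y = to_ac t" using mem_range_to_ac by auto
    have "z \<noteq> 0" using z by auto
    hence "t \<noteq> 0" using y t q1 by (auto simp: power_0_left)
    thus ?thesis using y t by auto
  qed
  have "root_char (q + 1) \<Psi>"
    unfolding root_char_def
  proof (intro conjI allI impI)
    fix z w :: "'a alg_closure" assume z: "z ^ (q + 1) = 1" and w: "w ^ (q + 1) = 1"
    from ex[OF z] ex[OF w] obtain y t where yt: "y \<noteq> 0" "z = to_ac (y ^ (q - 1))"
      "t \<noteq> 0" "w = to_ac (t ^ (q - 1))" by auto
    have "z * w = to_ac ((y * t) ^ (q - 1))" using yt by (simp add: power_mult_distrib)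
    thus "\<Psi> (z * w) = \<Psi> z * \<Psi> w"
      using yt val[of "y * t"] val[of y] val[of t] by (simp add: \<chi>' del: to_ac_power)
  next
    fix z :: "'a alg_closure" assume "z ^ (q + 1) = 1"
    from ex[OF this] obtain y where y: "y \<noteq> 0" "z = to_ac (y ^ (q - 1))" by auto
    show "norm (\<Psi> z) = 1" unfolding y(2) val[OF y(1)] using \<chi>'(3)[of y] y(1) by simp
  qed (simp add: \<Psi>_def)
  moreover have "lift_char (q + 1) \<Psi> (q\<^sup>2) (to_ac y) = \<chi> y" for y
  proof -
    have "lift_char (q + 1) \<Psi> (q\<^sup>2) (to_ac y) = \<Psi> (to_ac (y ^ (q - 1)))"
      unfolding lift_char_def quotient_exponent by simp
    also have "\<dots> = \<chi> y"
      using val[of y] q1 by (cases "y = 0") (auto simp: \<Psi>_def \<chi>' power_0_left)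
    finally show ?thesis .
  qed
  ultimately show ?thesis using that by blast
qed

text \<open>
  If \<open>\<chi>^3\<close> is trivial, the quadratic coefficient of the L-function has absolute value \<open>q\<close> instead
  of \<open>q^2\<close>, and one step of the recursion followed by the Weil bound over the quadratic extension
  gives an estimate that excludes the value \<open>2 q\<close>.
\<close>

lemma norm_cubic_sum_le:
  assumes p: "prime CHAR('a)" and w: "w \<noteq> 0" "\<chi> w ^ 2 \<noteq> 1" and c: "c \<in> K" "c \<noteq> 0" "c \<noteq> 1"
  shows "norm (cubic_sum UNIV \<chi> c) \<le> 2 * real q"
    and "(\<And>x. x \<noteq> 0 \<Longrightarrow> \<chi> x ^ 3 = 1) \<Longrightarrow> norm (cubic_sum UNIV \<chi> c) ^ 2 \<le> 2 * (real q)\<^sup>2 + 2 * real q"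
proof -
  obtain \<Psi> where \<Psi>: "root_char (q + 1) \<Psi>" and lift: "\<And>y. lift_char (q + 1) \<Psi> (q\<^sup>2) (to_ac y) = \<chi> y"
    using root_char_of_char by blast
  obtain k where k: "k > 0" "q = CHAR('a) ^ k" using card_finite_subfield[OF K _ p] card_K by auto
  have p': "prime CHAR('a alg_closure)" using p by simp
  have q': "q = CHAR('a alg_closure) ^ k" using k by simp
  have "of_nat q = (of_nat CHAR('a alg_closure) :: 'a alg_closure) ^ k" by (simp only: q' of_nat_power)
  hence q0: "of_nat q = (0 :: 'a alg_closure)" unfolding of_nat_CHAR using k(1) by simp
  have d: "q + 1 \<ge> 3" "of_nat (q + 1) \<noteq> (0 :: 'a alg_closure)" "q + 1 dvd q\<^sup>2 - 1"
  proof -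
    show "q + 1 dvd q\<^sup>2 - 1" by (simp only: square_minus_1 dvd_triv_left)
  qed (use q1 q0 in simp_all)
  have P1: "q\<^sup>2 > 1" using q1 by (rule one_less_power) simp
  have val: "\<exists>z. z ^ (q + 1) = 1 \<and> \<Psi> z = \<chi> y" if "y \<noteq> 0" for y
  proof (intro exI conjI)
    have "y ^ (q\<^sup>2 - 1) = 1"
      using finite_subfield_power_card[of UNIV y] fixfield_power_eq_1[of y "q\<^sup>2"] that q1
      by (simp add: is_subfield_def fixfield_def card_UNIV)
    hence "y ^ ((q - 1) * (q + 1)) = 1" by (simp only: square_minus_1 mult.commute[of "q + 1"])
    thus "to_ac (y ^ (q - 1)) ^ (q + 1) = 1"
      by (simp only: to_ac_power[symmetric] power_mult[symmetric] to_ac_1)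
    show "\<Psi> (to_ac (y ^ (q - 1))) = \<chi> y"
      using lift[of y] unfolding lift_char_def quotient_exponent by simp
  qed
  from val[OF w(1)] obtain v where v: "v ^ (q + 1) = 1" "\<Psi> v ^ 2 \<noteq> 1" using w(2) by auto
  have range: "range (to_ac :: 'a \<Rightarrow> _) = fixfield (q\<^sup>2)"
    by (simp add: range_to_ac_eq_fixfield card_UNIV)
  have c': "to_ac c \<in> fixfield (q\<^sup>2)" "to_ac c \<noteq> 0" "to_ac c \<noteq> 1"
    using c by (auto simp flip: range to_ac_1)
  have S: "cubic_sum (fixfield (q\<^sup>2)) (lift_char (q + 1) \<Psi> (q\<^sup>2)) (to_ac c) = cubic_sum UNIV \<chi> c"
    unfolding cubic_sum_def range[symmetric]
  proof (subst sum.reindex[OF inj_to_ac], rule sum.cong[OF refl])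
    fix x :: 'a
    show "((\<lambda>x. lift_char (q + 1) \<Psi> (q\<^sup>2) (x * (x + 1) * (x + to_ac c))) \<circ> to_ac) x =
        \<chi> (x * (x + 1) * (x + c))"
      using lift[of "x * (x + 1) * (x + c)"] by simp
  qed
  show "norm (cubic_sum UNIV \<chi> c) \<le> 2 * real q"
    using weil_bound_cubic_sum[OF \<Psi> p' q' k(1) d v c'] unfolding S .
  assume cube: "\<And>x. x \<noteq> 0 \<Longrightarrow> \<chi> x ^ 3 = 1"
  have P: "q\<^sup>2 = CHAR('a alg_closure) ^ (2 * k)" by (simp add: q' mult.commute flip: power_mult)
  obtain a where a: "norm (cubic_sum UNIV \<chi> c) ^ 2 \<le>
        norm (cubic_sum (fixfield ((q\<^sup>2)\<^sup>2)) (lift_char (q + 1) \<Psi> ((q\<^sup>2)\<^sup>2)) (to_ac c)) + 2 * a" "a \<ge> 0"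
      "complex_of_real (a\<^sup>2) = of_nat (q\<^sup>2) * (of_nat (q\<^sup>2) - (\<Sum>x\<in>fixfield (q\<^sup>2). lift_char (q + 1) \<Psi> (q\<^sup>2) x ^ 3))"
    using norm_cubic_sum_square_le_quadratic_extension[OF \<Psi> P1 d(3) p' P v c'] unfolding S by blast
  have "(\<Sum>x\<in>fixfield (q\<^sup>2). lift_char (q + 1) \<Psi> (q\<^sup>2) x ^ 3) = of_nat (q\<^sup>2) - 1"
  proof (rule sum_lift_char_cube_trivial[OF \<Psi> P1 d(3) p' P])
    fix t :: "'a alg_closure" assume t: "t ^ (q + 1) = 1"
    obtain y where y: "y ^ (q - 1) = t" using nth_root_exists[of "q - 1"] q1 by auto
    have "y ^ (q\<^sup>2 - 1) = 1"
      using t unfolding square_minus_1 mult.commute[of "q + 1"] power_mult y .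
    then obtain x where x: "y = to_ac x" using mem_range_to_ac by auto
    have "t \<noteq> 0" using t by auto
    hence "x \<noteq> 0" using y x q1 by (auto simp: power_0_left)
    moreover have "\<Psi> t = \<chi> x" using lift[of x] y x unfolding lift_char_def quotient_exponent by simp
    ultimately show "\<Psi> t ^ 3 = 1" using cube by simp
  qed
  hence "complex_of_real (a\<^sup>2) = complex_of_real ((real q)\<^sup>2)" using a(3) by simp
  hence "a\<^sup>2 = (real q)\<^sup>2" by (simp only: of_real_eq_iff)
  hence "a = real q" using a(2) by (simp add: power2_eq_iff_nonneg)
  moreover have "norm (cubic_sum (fixfield ((q\<^sup>2)\<^sup>2)) (lift_char (q + 1) \<Psi> ((q\<^sup>2)\<^sup>2)) (to_ac c)) \<le> 2 * real (q\<^sup>2)"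
  proof (rule weil_bound_cubic_sum[OF \<Psi> p' P _ d(1,2) _ v _ c'(2,3)])
    show "q + 1 dvd (q\<^sup>2)\<^sup>2 - 1" using q1 by (intro dvd_square_minus_1[OF d(3)]) simp
    show "to_ac c \<in> fixfield ((q\<^sup>2)\<^sup>2)" by (rule fixfield_mono_power[OF c'(1)])
  qed (use k in simp)
  ultimately show "norm (cubic_sum UNIV \<chi> c) ^ 2 \<le> 2 * (real q)\<^sup>2 + 2 * real q" using a(1) by simp
qed

end

theorem theorem1p3:
  fixes K :: "'a::{field, finite} set"
    and \<chi> :: "'a \<Rightarrow> complex"
    and p q d N :: nat
  assumes "is_subfield K"
    and "card K = q"
    and "CARD('a) = q ^ 2"
    and "CHAR('a) = p"
    and "p \<ge> 5"
    and "d = q + 1"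
    and "mult_char \<chi>"
    and "char_order \<chi> > 2"
    and "char_order \<chi> dvd d"
    and "N = card {c \<in> K. (\<Sum>x\<in>UNIV. \<chi> (x * (x + 1) * (x + c))) = 2 * of_nat q}"
  shows "real N \<le> (3 * real q - 9) / 4"
proof -
  note K = assms(1) and card_K = assms(2) and card_UNIV = assms(3)
  note KD = is_subfieldD[OF K]
  have UNIV: "is_subfield (UNIV :: 'a set)" by (simp add: is_subfield_def)
  have p: "prime CHAR('a)"
    using prime_CHAR_semidom[where ?'a = 'a] assms(4,5) by simp
  obtain k where k: "k > 0" "q = CHAR('a) ^ k" using card_finite_subfield[OF K _ p] card_K by auto
  have "p \<le> p ^ k" using k(1) assms(5) by (intro self_le_power) auto
  hence q5: "q \<ge> 5" using k assms(4,5) by simp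
  have ord: "\<chi> x ^ (q + 1) = 1" if "x \<noteq> 0" for x
    using char_order_dvd_imp(1)[OF assms(7,9) that] assms(6) by simp
  obtain w where w: "w \<noteq> 0" "\<chi> w ^ 2 \<noteq> 1"
    using char_order_dvd_imp(2)[OF assms(7,9) one_neq_zero assms(8)] by blast
  have \<chi>: "char_on UNIV \<chi>"
    unfolding char_on_def
  proof (intro conjI ballI impI)
    show "\<chi> 0 = 0" using assms(7) by (simp add: mult_char_def)
    show "\<chi> (x * y) = \<chi> x * \<chi> y" for x y
      using assms(7) by (cases "x = 0 \<or> y = 0") (auto simp: mult_char_def)
    show "norm (\<chi> x) = 1" if "x \<noteq> 0" for x
    proof -
      have "norm (\<chi> x) ^ (q + 1) = 1 ^ (q + 1)" using ord[OF that] by (metis norm_one norm_power power_one)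
      thus ?thesis by (rule power_eq_imp_eq_base) auto
    qed
  qed
  have triv: "\<chi> x = 1" if "x \<in> K" "x \<noteq> 0" for x
    by (rule char_trivial_on_subfield[OF K card_K card_UNIV \<chi> ord that])
  have vanish: "(\<Sum>x\<in>UNIV. \<chi> x ^ n) = 0" if "n > 0" "y \<noteq> 0" "\<chi> y ^ n \<noteq> 1" for n y
    by (rule sum_char_on_eq_0[OF char_on_power[OF \<chi> that(1)] UNIV _ _ that(2,3)]) simp_all
  have "\<chi> w \<noteq> 1" using w by auto
  hence s1: "(\<Sum>x\<in>UNIV. \<chi> x) = 0" using vanish[of 1 w] w by simp
  have s2: "(\<Sum>x\<in>UNIV. \<chi> x * \<chi> x) = 0" using vanish[of 2 w] w by (simp add: power2_eq_square)
  define S where "S = cubic_sum UNIV \<chi>"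
  define T where "T = {c \<in> K. S c = 2 * of_nat q}"
  have N: "N = card T" using assms(10) by (simp add: T_def S_def cubic_sum_def)
  have deg: "(of_nat q - 1) * S c = (of_nat q - 1) * of_nat q - (\<Sum>x\<in>UNIV. \<chi> x ^ 3)"
    if "c \<in> {0, 1}" for c
    unfolding S_def by (rule cubic_sum_degenerate[OF K card_K card_UNIV \<chi> triv s1 s2 that])
  have ne: "of_nat q - 1 \<noteq> (0::complex)" using q5 by simp
  note bounds = norm_cubic_sum_le[OF K card_K card_UNIV \<chi> ord p w, folded S_def]
  show ?thesis
  proof (cases "\<forall>x. x \<noteq> 0 \<longrightarrow> \<chi> x ^ 3 = 1")
    case True
    have "S c \<noteq> 2 * of_nat q" if c: "c \<in> K" for c
    proof (cases "c \<in> {0, 1}")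
      case False
      hence "norm (S c) ^ 2 \<le> 2 * (real q)\<^sup>2 + 2 * real q" using bounds(2) c True by auto
      also have "\<dots> < (2 * real q)\<^sup>2" using q5 by (simp add: power2_eq_square)
      finally show ?thesis by auto
    next
      case c01: True
      have "(\<Sum>x\<in>UNIV. \<chi> x ^ 3) = (\<Sum>x\<in>UNIV-{0}. \<chi> x ^ 3)"
        by (intro sum.mono_neutral_right) (auto simp: char_on_simps[OF \<chi>])
      also have "\<dots> = (\<Sum>x\<in>UNIV-{0::'a}. 1)" using True by (intro sum.cong) auto
      also have "\<dots> = of_nat (q\<^sup>2 - 1)" using card_UNIV by (simp add: card_Diff_singleton)
      also have "\<dots> = (of_nat q - 1) * (of_nat q + 1)"
        using q5 by (simp add: of_nat_diff power2_eq_square algebra_simps)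
      finally have "(of_nat q - 1) * S c = (of_nat q - 1) * (-1)"
        unfolding deg[OF c01] by (simp add: algebra_simps)
      hence "S c = -1" using ne by (metis mult_left_cancel)
      thus ?thesis using q5 by (simp add: complex_eq_iff)
    qed
    hence "T = {}" by (auto simp: T_def)
    thus ?thesis using N q5 by simp
  next
    case False
    then obtain y where "y \<noteq> 0" "\<chi> y ^ 3 \<noteq> 1" by auto
    hence "(\<Sum>x\<in>UNIV. \<chi> x ^ 3) = 0" by (intro vanish) auto
    hence S01: "S c = of_nat q" if "c \<in> {0, 1}" for c
      using deg[OF that] ne by simp
    define K' where "K' = K - {0, 1}"
    have "card K' = q - 2" unfolding K'_def using KD(1,2) card_K by (subst card_Diff_subset) auto
    hence cK': "real (card K') = real q - 2" using q5 by simp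
    have "T \<subseteq> K'" using S01 q5 by (auto simp: T_def K'_def)
    have "(\<Sum>c\<in>K. S c) = S 0 + S 1 + (\<Sum>c\<in>K'. S c)"
    proof -
      have "K = insert 0 (insert 1 K')" using KD(1,2) by (auto simp: K'_def)
      hence "sum S K = sum S (insert 0 (insert 1 K'))" by simp
      thus ?thesis by (simp add: K'_def)
    qed
    hence "(\<Sum>c\<in>K'. S c) = (of_nat q)\<^sup>2 - 5 * of_nat q"
      using sum_cubic_sums[OF K card_K card_UNIV \<chi> triv s1 s2] S01[of 0] S01[of 1] by (simp add: S_def)
    also have "\<dots> = complex_of_real ((real q)\<^sup>2 - 5 * real q)" by simp
    finally have "(\<Sum>c\<in>K'. Re (S c)) = (real q)\<^sup>2 - 5 * real q"
      by (metis Re_complex_of_real Re_sum)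
    \<comment> \<open>Outside \<open>T\<close> the Weil bound only says that \<open>Re (S c) \<ge> -2 q\<close>, so the first moment limits
      how many parameters can lie in \<open>T\<close>.\<close>
    moreover have "(\<Sum>c\<in>K'. (if c \<in> T then 2 * real q else - (2 * real q))) \<le> (\<Sum>c\<in>K'. Re (S c))"
    proof (rule sum_mono)
      fix c assume c: "c \<in> K'"
      show "(if c \<in> T then 2 * real q else - (2 * real q)) \<le> Re (S c)"
      proof (cases "c \<in> T")
        case False
        have "norm (S c) \<le> 2 * real q" using bounds(1) c by (auto simp: K'_def)
        thus ?thesis using False abs_Re_le_cmod[of "S c"] by auto
      qed (simp add: T_def)
    qed
    moreover have "(\<Sum>c\<in>K'. (if c \<in> T then 2 * real q else - (2 * real q))) =
       4 * real q * real N - 2 * real q * (real q - 2)"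
    proof -
      have "(\<Sum>c\<in>K'. (if c \<in> T then 2 * real q else - (2 * real q))) =
          (\<Sum>c\<in>K'. 4 * real q * (if c \<in> T then 1 else 0) - 2 * real q)"
        by (rule sum.cong) auto
      also have "\<dots> = 4 * real q * (\<Sum>c\<in>K'. if c \<in> T then 1 else 0) - 2 * real q * real (card K')"
        by (simp add: sum_subtractf sum_distrib_left)
      also have "(\<Sum>c\<in>K'. if c \<in> T then 1 else 0) = real N"
        using \<open>T \<subseteq> K'\<close> N by (simp add: sum.If_cases Int_absorb1)
      finally show ?thesis using cK' by simp
    qed
    ultimately have "4 * real q * real N - 2 * real q * (real q - 2) \<le> (real q)\<^sup>2 - 5 * real q" by simp
    hence "real q * (4 * real N) \<le> real q * (3 * real q - 9)"
      by (simp add: power2_eq_square algebra_simps)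
    hence "4 * real N \<le> 3 * real q - 9" using q5 by simp
    thus ?thesis by simp
  qed
qed

end
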